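(* Suppose $K=0$. There exists an absolute constant $C>0$ such that for any $b,h\in[0,1]$, $L\in\mathbb{Z}_{\ge 0}$, $U>0$, $T\in\mathbb{Z}_{>0}$, any probability distribution $\mathcal{D}$ on $[0,U]^{T+L}$, and any $N\in\mathbb{Z}_{>0}$, taking the class of non-stationary base-stock policies $\Pi_{(S^t)}=[0,H]^{T+L}$ with $H=(L+1)U$, $$\mathbb{E}_{\mathbf{d}_1,\dots,\mathbf{d}_N\sim\mathcal{D}}\big[\mathrm{EE}(\mathcal{L}(\Pi_{(S^t)}))\big]\le \mathbb{E}_{\mathbf{d}_1,\dots,\mathbf{d}_N\sim\mathcal{D}}\big[\mathrm{GE}(\mathcal{L}(\Pi_{(S^t)}))\big]\le C(L+1)U\sqrt{\frac1N}.$$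
   Context: Inventory model (backlogged demand, lead time $L$). There are $T+L$ periods; a demand sequence is $\mathbf{d}=(d^1,\dots,d^{T+L})\in[0,U]^{T+L}$. Let $x^t$ be the inventory level at the beginning of period $t$ and $q^t\ge 0$ the quantity ordered in period $t$ (arriving in period $t+L$), with $q^t=0$ for $t\le 0$. The inventory position before ordering is $I^t=x^t+\sum_{t'=t-L}^{t-1}q^{t'}$. After replenishment the inventory level is $y^t=x^t+q^{t-L}$, and $x^{t+1}=y^t-d^t$. The initial level $x^1\le 0$ is a fixed constant. Let $c(x)=h\max\{x,0\}+b\max\{-x,0\}$. With fixed ordering cost $K$, the loss in period $t$ of a policy $\pi$ is $\ell^t(\pi,\mathbf{d})=c(y^t-d^t)+K\cdot\mathbb{I}\{q^{t-L}>0\}$ (so $\ell^t=c(y^t-d^t)$ when $K=0$), and the loss is $\ell(\pi,\mathbf{d})=\frac1T\sum_{t=L+1}^{T+L}\ell^t(\pi,\mathbf{d})$. Non-stationary base-stock policies: a policy $(S^t)_{t=1}^{T+L}\in[0,H]^{T+L}$ orders $q^t=\max\{S^t-I^t,0\}$ in period $t$. Errors: $\mathbf{d}_1,\dots,\mathbf{d}_N$ are i.i.d. from $\mathcal{D}$; $\mathcal{L}(\Pi)=\{\ell(\pi,\cdot):\pi\in\Pi\}$; $R(\pi)=\mathbb{E}_{\mathbf{d}\sim\mathcal{D}}[\ell(\pi,\mathbf{d})]$; $\hat R(\pi)=\frac1N\sum_{i=1}^N\ell(\pi,\mathbf{d}_i)$. The generalization error is $\mathrm{GE}(\mathcal{L}(\Pi))=\sup_{\pi\in\Pi}\{R(\pi)-\hat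 R(\pi)\}$. The estimation error is $\mathrm{EE}(\mathcal{L}(\Pi))=R(\hat\pi)-R(\pi^* )$, where $\hat\pi\in\arg\inf_{\pi\in\Pi}\hat R(\pi)$ and $\pi^*\in\arg\inf_{\pi\in\Pi}R(\pi)$ (minimizers presumed to exist). *)

theory Defs
  imports "HOL-Probability.Probability"
begin

text \<open>
  Periods are natural numbers \<open>1, 2, \<dots>\<close>. There are no orders in periods \<open>t \<le> 0\<close>; as
  \<open>order\<close> vanishes at \<open>0\<close>, the truncated difference \<open>t - L\<close> gives the correct value for
  \<open>t \<le> L\<close> both for the arriving order and in the sum over the pipeline.
  A policy is identified with its sequence \<open>S\<close> of base-stock levels; \<open>x1\<close> is the initial
  inventory level. The value of \<open>inv_level\<close> at \<open>0\<close> is irrelevant.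
\<close>

function (sequential)
  inv_level :: "real \<Rightarrow> nat \<Rightarrow> (nat \<Rightarrow> real) \<Rightarrow> (nat \<Rightarrow> real) \<Rightarrow> nat \<Rightarrow> real" and
  order_qty :: "real \<Rightarrow> nat \<Rightarrow> (nat \<Rightarrow> real) \<Rightarrow> (nat \<Rightarrow> real) \<Rightarrow> nat \<Rightarrow> real"
where
  "inv_level x1 L S d t =
     (if t \<le> 1 then x1
      else inv_level x1 L S d (t - 1) + order_qty x1 L S d (t - 1 - L) - d (t - 1))"
| "order_qty x1 L S d t =
     (if t = 0 then 0
      else max (S t - (inv_level x1 L S d t + (\<Sum>t'\<in>{t - L..<t}. order_qty x1 L S d t'))) 0)"
  by pat_completeness auto
termination
  by (relation "Wellfounded.measure (\<lambda>p. case p of Inl (_, _, _, _, t) \<Rightarrow> 2 * t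
                                     | Inr (_, _, _, _, t) \<Rightarrow> 2 * t + 1)") auto

declare inv_level.simps [simp del] order_qty.simps [simp del]

definition inv_position ::
  "real \<Rightarrow> nat \<Rightarrow> (nat \<Rightarrow> real) \<Rightarrow> (nat \<Rightarrow> real) \<Rightarrow> nat \<Rightarrow> real" where
  "inv_position x1 L S d t = inv_level x1 L S d t + (\<Sum>t'\<in>{t - L..<t}. order_qty x1 L S d t')"

definition inv_after ::
  "real \<Rightarrow> nat \<Rightarrow> (nat \<Rightarrow> real) \<Rightarrow> (nat \<Rightarrow> real) \<Rightarrow> nat \<Rightarrow> real" where
  "inv_after x1 L S d t = inv_level x1 L S d t + order_qty x1 L S d (t - L)"

lemma inv_level_1: "inv_level x1 L S d 1 = x1"
  by (simp add: inv_level.simps)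

lemma inv_level_Suc:
  "t \<ge> 1 \<Longrightarrow> inv_level x1 L S d (t + 1) = inv_after x1 L S d t - d t"
  by (subst inv_level.simps) (simp add: inv_after_def)

lemma order_qty_base_stock:
  "t \<ge> 1 \<Longrightarrow> order_qty x1 L S d t = max (S t - inv_position x1 L S d t) 0"
  by (subst order_qty.simps) (simp add: inv_position_def)

lemma order_qty_0: "order_qty x1 L S d 0 = 0"
  by (simp add: order_qty.simps)

definition holding_backlog_cost :: "real \<Rightarrow> real \<Rightarrow> real \<Rightarrow> real" where
  "holding_backlog_cost h b x = h * max x 0 + b * max (- x) 0"

definition period_loss ::
  "real \<Rightarrow> real \<Rightarrow> real \<Rightarrow> real \<Rightarrow> nat \<Rightarrow> nat \<Rightarrow> (nat \<Rightarrow> real) \<Rightarrow> (nat \<Rightarrow> real) \<Rightarrow> real" where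
  "period_loss K h b x1 L t S d =
     holding_backlog_cost h b (inv_after x1 L S d t - d t)
     + K * of_bool (order_qty x1 L S d (t - L) > 0)"

definition loss ::
  "real \<Rightarrow> real \<Rightarrow> real \<Rightarrow> real \<Rightarrow> nat \<Rightarrow> nat \<Rightarrow> (nat \<Rightarrow> real) \<Rightarrow> (nat \<Rightarrow> real) \<Rightarrow> real" where
  "loss K h b x1 L T S d = (1 / real T) * (\<Sum>t=L+1..T+L. period_loss K h b x1 L t S d)"

definition base_stock_policies :: "real \<Rightarrow> nat \<Rightarrow> nat \<Rightarrow> (nat \<Rightarrow> real) set" where
  "base_stock_policies H L T = PiE {1..T+L} (\<lambda>_. {0..H})"

definition demand_space :: "real \<Rightarrow> nat \<Rightarrow> nat \<Rightarrow> (nat \<Rightarrow> real) measure" where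
  "demand_space U L T = PiM {1..T+L} (\<lambda>_. restrict_space borel {0..U})"

definition risk :: "'d measure \<Rightarrow> ('p \<Rightarrow> 'd \<Rightarrow> real) \<Rightarrow> 'p \<Rightarrow> real" where
  "risk D l p = (\<integral>d. l p d \<partial>D)"

definition emp_risk :: "nat \<Rightarrow> ('p \<Rightarrow> 'd \<Rightarrow> real) \<Rightarrow> (nat \<Rightarrow> 'd) \<Rightarrow> 'p \<Rightarrow> real" where
  "emp_risk N l \<omega> p = (1 / real N) * (\<Sum>i=1..N. l p (\<omega> i))"

text \<open>
  For base-stock policies with levels in \<open>[0,H]\<close> and demands in \<open>[0,U]\<close> the losses are
  uniformly bounded, so the real-valued \<open>SUP\<close> below is a genuine supremum.
\<close>

definition gen_error ::
  "'d measure \<Rightarrow> nat \<Rightarrow> ('p \<Rightarrow> 'd \<Rightarrow> real) \<Rightarrow> 'p set \<Rightarrow> (nat \<Rightarrow> 'd) \<Rightarrow> real" where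
  "gen_error D N l P \<omega> = (SUP p\<in>P. risk D l p - emp_risk N l \<omega> p)"

text \<open>Here \<open>phat\<close> and \<open>pstar\<close> stand for minimizers of the empirical and of the true risk.\<close>

definition est_error :: "'d measure \<Rightarrow> ('p \<Rightarrow> 'd \<Rightarrow> real) \<Rightarrow> 'p \<Rightarrow> 'p \<Rightarrow> real" where
  "est_error D l phat pstar = risk D l phat - risk D l pstar"

definition samples :: "'d measure \<Rightarrow> nat \<Rightarrow> (nat \<Rightarrow> 'd) measure" where
  "samples D N = PiM {1..N} (\<lambda>_. D)"

end

theory Submission imports Defs begin

text \<open>
  Unrolling the recursion, the inventory at the end of period \<open>r + L\<close> is the maximum over
  \<open>s \<le> r\<close> of \<open>S s\<close> minus the demand of the periods \<open>s, \<dots>, r + L\<close>. By symmetrization it suffices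
  to bound, for each \<open>r\<close> separately, the Rademacher average of this class on every fixed sample;
  \<open>r\<close> may be large, so its size must not enter. Cumulative demand decreases in \<open>s\<close>, so once \<open>S\<close>
  is rounded to multiples of \<open>\<delta> = H / m\<close> only the largest \<open>s\<close> with \<open>S s \<ge> k \<delta>\<close> matters for each
  \<open>k \<le> m\<close>, and a decreasing curve of demand vectors has a net of polynomial size in \<open>m\<close>. So the entropy at scale
  \<open>H / m\<close> is of order \<open>m * ln m\<close>, independently of \<open>r\<close>, and the chaining sum converges.
\<close>

section \<open>Rademacher averages and chaining\<close>

text \<open>The demand accumulated over the periods \<open>s, ..., r + L\<close> can be of order
  \<open>(T + L) * U\<close>, whereas the bound sought is in units of
  \<open>H = (L + 1) * U\<close>. The choice \<open>s = r\<close> involves only \<open>L + 1\<close>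
  periods, so the maximum is at least \<open>- H\<close>; terms below that are irrelevant and the
  accumulated demand may be cut off at \<open>2 * H\<close>. After rounding, a policy is recorded by
  \<open>m + 1\<close> indices that must serve all sample points simultaneously. Moving these
  indices to net points perturbs a maximum of \<open>m + 1\<close> entries, whose squared error is
  bounded by the sum of the squared errors; the net on the curve is therefore made finer by a factor
  \<open>m + 1\<close>. This costs one more power of \<open>m\<close>, which is harmless inside a
  logarithm. With \<open>m = 2 ^ j\<close> the links have size of order
  \<open>2 ^ (- j) * sqrt (j * 2 ^ j)\<close>; a single scale would give a rate slower than
  \<open>1 / sqrt N\<close>. Two measure-theoretic points remain: the supremum over the uncountable
  class is shown measurable through a countable dense subclass, and the empirical minimizer may be
  chosen in a non-measurable way.\<close>

lemma exp_plus_exp_minus_le: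
  fixes x :: real
  shows "exp x + exp (- x) \<le> 2 * exp (x\<^sup>2 / 2)"
proof -
  have *: "exp y + exp (- y) \<le> 2 * exp (y\<^sup>2 / 2)" if "y \<ge> 0" for y :: real
  proof -
    \<comment> \<open>The left-hand side is \<open>ln (cosh y)\<close>, the log moment generating
      function of a fair two-point variable. The cited bound concerns nonnegative arguments;
      evenness covers the rest.\<close>
    have "- y + ln ((1 + exp (2 * y)) / 2) \<le> y\<^sup>2 / 2"
      using Hoeffdings_lemma_aux[of "2 * y" "1 / 2"] that
      by (simp add: power_mult_distrib field_simps)
    then have "exp (- y + ln ((1 + exp (2 * y)) / 2)) \<le> exp (y\<^sup>2 / 2)"
      by (simp only: exp_le_cancel_iff)
    moreover have "exp (- y + ln ((1 + exp (2 * y)) / 2)) = exp (- y) * ((1 + exp (2 * y)) / 2)"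
      by (simp only: exp_add, subst exp_ln) (simp_all add: add_pos_pos)
    moreover have "exp (- y) * ((1 + exp (2 * y)) / 2) = (exp y + exp (- y)) / 2"
      by (simp add: distrib_left flip: exp_add)
    ultimately have "(exp y + exp (- y)) / 2 \<le> exp (y\<^sup>2 / 2)" by (simp only:)
    then show ?thesis by (simp only: field_simps)
  qed
  show ?thesis
    using *[of x] *[of "- x"] by (cases "x \<ge> 0") auto
qed

section \<open>Averages over random signs\<close>

definition sign_vectors :: "'i set \<Rightarrow> ('i \<Rightarrow> real) set" where
  "sign_vectors I = PiE I (\<lambda>_. {-1, 1})"

text \<open>This bounds by \<open>c\<close> the average over uniform signs of the supremum over
  \<open>F\<close>, without the factor \<open>1 / card I\<close>. The supremum is represented by a
  majorant \<open>X\<close>, which avoids real-valued suprema and their side conditions; the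
  expectation is a plain finite sum.\<close>

definition rademacher_le :: "'i set \<Rightarrow> ('i \<Rightarrow> real) set \<Rightarrow> real \<Rightarrow> bool" where
  "rademacher_le I F c \<longleftrightarrow>
     (\<exists>X. (\<forall>\<sigma>\<in>sign_vectors I. \<forall>f\<in>F. (\<Sum>i\<in>I. \<sigma> i * f i) \<le> X \<sigma>) \<and>
          (\<Sum>\<sigma>\<in>sign_vectors I. X \<sigma>) \<le> 2 ^ card I * c)"

lemma card_sign_vectors: "finite I \<Longrightarrow> card (sign_vectors I) = 2 ^ card I"
  by (simp add: sign_vectors_def card_PiE numeral_2_eq_2)

lemma sign_vectors_sq: "\<sigma> \<in> sign_vectors I \<Longrightarrow> i \<in> I \<Longrightarrow> \<sigma> i * \<sigma> i = 1"
  by (fastforce simp: sign_vectors_def PiE_def Pi_def)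

lemma sign_vectors_abs: "\<sigma> \<in> sign_vectors I \<Longrightarrow> i \<in> I \<Longrightarrow> \<bar>\<sigma> i\<bar> = 1"
  by (fastforce simp: sign_vectors_def PiE_def Pi_def)

lemma rademacher_le_subset:
  assumes "rademacher_le I G c" "c \<le> c'"
    and "\<And>f. f \<in> F \<Longrightarrow> \<exists>g\<in>G. \<forall>i\<in>I. f i = g i"
  shows "rademacher_le I F c'"
proof -
  obtain X where X: "\<And>\<sigma> g. \<sigma> \<in> sign_vectors I \<Longrightarrow> g \<in> G \<Longrightarrow> (\<Sum>i\<in>I. \<sigma> i * g i) \<le> X \<sigma>"
    and S: "(\<Sum>\<sigma>\<in>sign_vectors I. X \<sigma>) \<le> 2 ^ card I * c"
    using assms(1) unfolding rademacher_le_def by blast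
  have "(\<Sum>i\<in>I. \<sigma> i * f i) \<le> X \<sigma>" if \<sigma>: "\<sigma> \<in> sign_vectors I" and "f \<in> F" for \<sigma> f
  proof -
    obtain g where "g \<in> G" "\<forall>i\<in>I. f i = g i" using assms(3)[OF \<open>f \<in> F\<close>] by blast
    then show ?thesis using X[OF \<sigma> \<open>g \<in> G\<close>] by simp
  qed
  moreover have "(\<Sum>\<sigma>\<in>sign_vectors I. X \<sigma>) \<le> 2 ^ card I * c'"
    using S assms(2) by (meson dual_order.trans mult_left_mono zero_le_numeral zero_le_power)
  ultimately show ?thesis unfolding rademacher_le_def by blast
qed

lemma rademacher_le_add:
  assumes "rademacher_le I F a" "rademacher_le I G b"
  shows "rademacher_le I {\<lambda>i. f i + g i |f g. f \<in> F \<and> g \<in> G} (a + b)"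
proof -
  obtain X where X: "\<And>\<sigma> g. \<sigma> \<in> sign_vectors I \<Longrightarrow> g \<in> F \<Longrightarrow> (\<Sum>i\<in>I. \<sigma> i * g i) \<le> X \<sigma>"
    and SX: "(\<Sum>\<sigma>\<in>sign_vectors I. X \<sigma>) \<le> 2 ^ card I * a"
    using assms(1) unfolding rademacher_le_def by blast
  obtain Y where Y: "\<And>\<sigma> g. \<sigma> \<in> sign_vectors I \<Longrightarrow> g \<in> G \<Longrightarrow> (\<Sum>i\<in>I. \<sigma> i * g i) \<le> Y \<sigma>"
    and SY: "(\<Sum>\<sigma>\<in>sign_vectors I. Y \<sigma>) \<le> 2 ^ card I * b"
    using assms(2) unfolding rademacher_le_def by blast
  show ?thesis
    unfolding rademacher_le_def
  proof (intro exI[of _ "\<lambda>\<sigma>. X \<sigma> + Y \<sigma>"] conjI ballI)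
    fix \<sigma> k assume \<sigma>: "\<sigma> \<in> sign_vectors I" and "k \<in> {\<lambda>i. f i + g i |f g. f \<in> F \<and> g \<in> G}"
    then obtain f g where k: "k = (\<lambda>i. f i + g i)" "f \<in> F" "g \<in> G" by blast
    show "(\<Sum>i\<in>I. \<sigma> i * k i) \<le> X \<sigma> + Y \<sigma>"
      using add_mono[OF X[OF \<sigma> k(2)] Y[OF \<sigma> k(3)]]
      by (simp add: k(1) sum.distrib distrib_left)
  next
    show "(\<Sum>\<sigma>\<in>sign_vectors I. X \<sigma> + Y \<sigma>) \<le> 2 ^ card I * (a + b)"
      using add_mono[OF SX SY] by (simp add: sum.distrib distrib_left)
  qed
qed

lemma rademacher_le_scale:
  assumes "rademacher_le I F a" "c \<ge> 0"
  shows "rademacher_le I ((\<lambda>f i. c * f i) ` F) (c * a)"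
proof -
  obtain X where X: "\<And>\<sigma> g. \<sigma> \<in> sign_vectors I \<Longrightarrow> g \<in> F \<Longrightarrow> (\<Sum>i\<in>I. \<sigma> i * g i) \<le> X \<sigma>"
    and SX: "(\<Sum>\<sigma>\<in>sign_vectors I. X \<sigma>) \<le> 2 ^ card I * a"
    using assms(1) unfolding rademacher_le_def by blast
  show ?thesis
    unfolding rademacher_le_def
  proof (intro exI[of _ "\<lambda>\<sigma>. c * X \<sigma>"] conjI ballI)
    fix \<sigma> k assume \<sigma>: "\<sigma> \<in> sign_vectors I" and "k \<in> (\<lambda>f i. c * f i) ` F"
    then obtain f where k: "k = (\<lambda>i. c * f i)" "f \<in> F" by blast
    have "(\<Sum>i\<in>I. \<sigma> i * k i) = c * (\<Sum>i\<in>I. \<sigma> i * f i)"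
      by (simp add: k(1) sum_distrib_left mult_ac)
    also have "\<dots> \<le> c * X \<sigma>" using X[OF \<sigma> k(2)] assms(2) by (rule mult_left_mono)
    finally show "(\<Sum>i\<in>I. \<sigma> i * k i) \<le> c * X \<sigma>" .
  next
    show "(\<Sum>\<sigma>\<in>sign_vectors I. c * X \<sigma>) \<le> 2 ^ card I * (c * a)"
      using mult_left_mono[OF SX assms(2)] by (simp add: mult_ac flip: sum_distrib_left)
  qed
qed

text \<open>Negation is an involution of the sign vectors, so a minus can be moved from the
  functions to the signs without changing the average. This treats the half of the symmetrized
  difference that carries a minus.\<close>

lemma rademacher_le_uminus:
  assumes "rademacher_le I F c" "finite I"
  shows "rademacher_le I ((\<lambda>f i. - f i) ` F) c"
proof -
  obtain X where X: "\<And>\<sigma> g. \<sigma> \<in> sign_vectors I \<Longrightarrow> g \<in> F \<Longrightarrow> (\<Sum>i\<in>I. \<sigma> i * g i) \<le> X \<sigma>"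
    and S: "(\<Sum>\<sigma>\<in>sign_vectors I. X \<sigma>) \<le> 2 ^ card I * c"
    using assms(1) unfolding rademacher_le_def by blast
  define neg :: "('a \<Rightarrow> real) \<Rightarrow> 'a \<Rightarrow> real" where "neg = (\<lambda>\<sigma>. \<lambda>i\<in>I. - \<sigma> i)"
  have neg: "neg \<sigma> \<in> sign_vectors I" "neg (neg \<sigma>) = \<sigma>" if "\<sigma> \<in> sign_vectors I" for \<sigma>
  proof -
    show "neg \<sigma> \<in> sign_vectors I" using that by (fastforce simp: neg_def sign_vectors_def)
    have "\<sigma> \<in> extensional I" using that by (auto simp: sign_vectors_def PiE_def)
    then show "neg (neg \<sigma>) = \<sigma>" by (auto simp: neg_def fun_eq_iff extensional_def)
  qed
  show ?thesis unfolding rademacher_le_def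
  proof (intro exI[of _ "\<lambda>\<sigma>. X (neg \<sigma>)"] conjI ballI)
    fix \<sigma> k assume \<sigma>: "\<sigma> \<in> sign_vectors I" and "k \<in> (\<lambda>f i. - f i) ` F"
    then obtain f where f: "k = (\<lambda>i. - f i)" "f \<in> F" by blast
    have "(\<Sum>i\<in>I. \<sigma> i * k i) = (\<Sum>i\<in>I. neg \<sigma> i * f i)"
      by (intro sum.cong) (auto simp: f neg_def)
    then show "(\<Sum>i\<in>I. \<sigma> i * k i) \<le> X (neg \<sigma>)" using X[OF neg(1)[OF \<sigma>] f(2)] by simp
  next
    have "(\<Sum>\<sigma>\<in>sign_vectors I. X (neg \<sigma>)) = (\<Sum>\<sigma>\<in>sign_vectors I. X \<sigma>)"
      by (rule sum.reindex_bij_witness[of _ neg neg]) (use neg in auto)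
    then show "(\<Sum>\<sigma>\<in>sign_vectors I. X (neg \<sigma>)) \<le> 2 ^ card I * c" using S by simp
  qed
qed

lemma sum_sign_vectors_eq_0:
  assumes "finite I" "i \<in> I"
  shows "(\<Sum>\<sigma>\<in>sign_vectors I. \<sigma> i) = 0"
proof -
  \<comment> \<open>Padding \<open>\<sigma> i\<close> with factors \<open>1\<close> makes the sum
    over the product set factorize; the factor of coordinate \<open>i\<close> is
    \<open>-1 + 1\<close>.\<close>
  have "(\<Sum>\<sigma>\<in>sign_vectors I. \<Prod>k\<in>I. if k = i then \<sigma> k else 1)
      = (\<Prod>k\<in>I. \<Sum>y\<in>{-1, 1::real}. if k = i then y else 1)"
    unfolding sign_vectors_def using assms by (subst prod_sum_PiE) auto
  also have "\<dots> = 0"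
    using assms by (intro prod_zero) auto
  finally show ?thesis using assms by (simp add: prod.delta)
qed

text \<open>The signs have mean zero, so a fixed vector costs nothing; a chain may start at a
  one-point net for free.\<close>

lemma rademacher_le_singleton:
  assumes "finite I"
  shows "rademacher_le I {v} 0"
  unfolding rademacher_le_def
proof (intro exI[of _ "\<lambda>\<sigma>. \<Sum>i\<in>I. \<sigma> i * v i"] conjI ballI)
  have "(\<Sum>\<sigma>\<in>sign_vectors I. \<Sum>i\<in>I. \<sigma> i * v i) = (\<Sum>i\<in>I. (\<Sum>\<sigma>\<in>sign_vectors I. \<sigma> i) * v i)"
    by (subst sum.swap) (simp add: sum_distrib_right)
  then show "(\<Sum>\<sigma>\<in>sign_vectors I. \<Sum>i\<in>I. \<sigma> i * v i) \<le> 2 ^ card I * 0"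
    using assms by (simp add: sum_sign_vectors_eq_0)
qed simp

text \<open>All summands share the same \<open>p\<close>; letting each have its own only enlarges
  the class. This permits treating the periods of the loss separately.\<close>

lemma rademacher_le_sum:
  assumes "finite A" "finite I" "\<And>r. r \<in> A \<Longrightarrow> rademacher_le I ((\<lambda>p. g r p) ` P) (c r)"
  shows "rademacher_le I ((\<lambda>p i. \<Sum>r\<in>A. g r p i) ` P) (\<Sum>r\<in>A. c r)"
  using assms(1,3)
proof (induction A rule: finite_induct)
  case empty
  show ?case
    by (rule rademacher_le_subset[OF rademacher_le_singleton[OF assms(2), of "\<lambda>_. 0"]]) auto
next
  case (insert r A)
  have "rademacher_le I ((\<lambda>p. g r p) ` P) (c r)"
    "rademacher_le I ((\<lambda>p i. \<Sum>r\<in>A. g r p i) ` P) (\<Sum>r\<in>A. c r)"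
    using insert by auto
  from rademacher_le_add[OF this] show ?case
    by (rule rademacher_le_subset) (use insert in auto)
qed

text \<open>Cauchy-Schwarz, as every sign vector has Euclidean norm \<open>sqrt (card I)\<close>. It
  covers infinite classes and so serves for the residual of a chain.\<close>

lemma rademacher_le_radius:
  assumes "finite I" "\<And>f. f \<in> F \<Longrightarrow> L2_set f I \<le> R"
  shows "rademacher_le I F (R * sqrt (card I))"
  unfolding rademacher_le_def
proof (intro exI[of _ "\<lambda>\<sigma>. R * sqrt (card I)"] conjI ballI)
  fix \<sigma> f assume \<sigma>: "\<sigma> \<in> sign_vectors I" and f: "f \<in> F"
  have "(\<Sum>i\<in>I. \<sigma> i * f i) \<le> (\<Sum>i\<in>I. \<bar>\<sigma> i\<bar> * \<bar>f i\<bar>)"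
    by (intro sum_mono) (metis abs_ge_self abs_mult)
  also have "\<dots> \<le> L2_set \<sigma> I * L2_set f I" by (rule L2_set_mult_ineq)
  also have "L2_set \<sigma> I = sqrt (card I)"
    by (simp add: L2_set_def power2_eq_square sign_vectors_sq[OF \<sigma>])
  also have "sqrt (card I) * L2_set f I \<le> sqrt (card I) * R"
    using assms(2)[OF f] by (intro mult_left_mono) auto
  finally show "(\<Sum>i\<in>I. \<sigma> i * f i) \<le> R * sqrt (card I)" by (simp add: mult.commute)
qed (use assms in \<open>simp add: card_sign_vectors\<close>)

text \<open>Independence of the signs factorizes the exponential moment, and each coordinate
  contributes \<open>2 * cosh (l * v i)\<close>.\<close>

lemma sum_sign_vectors_exp_le:
  fixes v :: "'i \<Rightarrow> real"
  assumes "finite I" "L2_set v I \<le> R"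
  shows "(\<Sum>\<sigma>\<in>sign_vectors I. exp (l * (\<Sum>i\<in>I. \<sigma> i * v i))) \<le> 2 ^ card I * exp (l\<^sup>2 * R\<^sup>2 / 2)"
proof -
  have "(\<Sum>\<sigma>\<in>sign_vectors I. exp (l * (\<Sum>i\<in>I. \<sigma> i * v i)))
      = (\<Sum>\<sigma>\<in>sign_vectors I. \<Prod>i\<in>I. exp (l * (\<sigma> i * v i)))"
    using assms by (simp add: sum_distrib_left exp_sum)
  also have "\<dots> = (\<Prod>i\<in>I. \<Sum>y\<in>{-1, 1::real}. exp (l * (y * v i)))"
    unfolding sign_vectors_def using assms by (subst prod_sum_PiE) auto
  also have "\<dots> \<le> (\<Prod>i\<in>I. 2 * exp ((l * v i)\<^sup>2 / 2))"
  proof (intro prod_mono conjI sum_nonneg)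
    fix i show "(\<Sum>y\<in>{-1, 1::real}. exp (l * (y * v i))) \<le> 2 * exp ((l * v i)\<^sup>2 / 2)"
      using exp_plus_exp_minus_le[of "l * v i"] by simp
  qed auto
  also have "\<dots> = 2 ^ card I * exp (l\<^sup>2 * (L2_set v I)\<^sup>2 / 2)"
    using assms(1)
    by (simp add: prod.distrib L2_set_def sum_nonneg power_mult_distrib sum_distrib_left
          flip: exp_sum sum_divide_distrib)
  also have "\<dots> \<le> 2 ^ card I * exp (l\<^sup>2 * R\<^sup>2 / 2)"
    using assms(2) by (simp add: mult_left_mono power_mono)
  finally show ?thesis .
qed

text \<open>In place of Jensen's inequality for the logarithm, the tangent bound
  \<open>x \<le> a - 1 + exp (x - a)\<close> is used, and the maximum over \<open>V\<close> is then
  dominated by the sum over \<open>V\<close>. This yields an explicit majorant \<open>X\<close>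
  whose average is computed by linearity.\<close>

lemma massart:
  assumes "finite I" "finite V" "R > 0" "\<Lambda> > 0" "real (card V) \<le> exp \<Lambda>"
    and V: "\<And>v. v \<in> V \<Longrightarrow> L2_set v I \<le> R"
  shows "rademacher_le I V (R * sqrt (2 * \<Lambda>))"
proof -
  \<comment> \<open>This value minimizes \<open>a / l\<close>, that is
    \<open>\<Lambda> / l + l * R ^ 2 / 2\<close>; both terms agree at the minimum, hence
    \<open>a = 2 * \<Lambda>\<close> below.\<close>
  define l where "l = sqrt (2 * \<Lambda>) / R"
  have l: "l > 0" using assms by (simp add: l_def)
  define a where "a = \<Lambda> + l\<^sup>2 * R\<^sup>2 / 2"
  have lR: "l * R = sqrt (2 * \<Lambda>)" using assms by (simp add: l_def)
  have a: "a = 2 * \<Lambda>" using assms by (simp add: a_def lR flip: power_mult_distrib)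
  have al: "a / l = R * sqrt (2 * \<Lambda>)"
  proof -
    have "a / l = R * (2 * \<Lambda> / sqrt (2 * \<Lambda>))" by (simp add: a l_def)
    then show ?thesis using assms(4) real_div_sqrt[of "2 * \<Lambda>"] by simp
  qed
  define X where "X = (\<lambda>\<sigma>. (a - 1 + (\<Sum>v\<in>V. exp (l * (\<Sum>i\<in>I. \<sigma> i * v i) - a))) / l)"
  show ?thesis unfolding rademacher_le_def
  proof (intro exI[of _ X] conjI ballI)
    fix \<sigma> v assume "v \<in> V"
    let ?s = "\<Sum>i\<in>I. \<sigma> i * v i"
    have "l * ?s \<le> a - 1 + exp (l * ?s - a)"
      using exp_ge_add_one_self[of "l * ?s - a"] by linarith
    also have "exp (l * ?s - a) \<le> (\<Sum>v\<in>V. exp (l * (\<Sum>i\<in>I. \<sigma> i * v i) - a))"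
      using \<open>v \<in> V\<close> assms(2) by (intro member_le_sum) auto
    finally show "?s \<le> X \<sigma>"
      using l by (simp add: X_def field_simps)
  next
    let ?n = "2 ^ card I :: real"
    have "(\<Sum>\<sigma>\<in>sign_vectors I. \<Sum>v\<in>V. exp (l * (\<Sum>i\<in>I. \<sigma> i * v i) - a))
        = (\<Sum>v\<in>V. (\<Sum>\<sigma>\<in>sign_vectors I. exp (l * (\<Sum>i\<in>I. \<sigma> i * v i))) * exp (- a))"
      by (subst sum.swap) (simp add: exp_diff exp_minus sum_distrib_right divide_inverse)
    also have "\<dots> \<le> (\<Sum>v\<in>V. (?n * exp (l\<^sup>2 * R\<^sup>2 / 2)) * exp (- a))"
      using assms(1) V by (intro sum_mono mult_right_mono sum_sign_vectors_exp_le) auto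
    also have "\<dots> = ?n * (real (card V) * exp (- \<Lambda>))"
      by (simp add: a_def mult_ac flip: exp_add)
    also have "\<dots> \<le> ?n * 1"
      using assms(5) by (intro mult_left_mono) (auto simp: exp_minus field_simps)
    finally have *: "(\<Sum>\<sigma>\<in>sign_vectors I. \<Sum>v\<in>V. exp (l * (\<Sum>i\<in>I. \<sigma> i * v i) - a)) \<le> ?n"
      by simp
    have "(\<Sum>\<sigma>\<in>sign_vectors I. X \<sigma>)
        = (?n * (a - 1) + (\<Sum>\<sigma>\<in>sign_vectors I. \<Sum>v\<in>V. exp (l * (\<Sum>i\<in>I. \<sigma> i * v i) - a))) / l"
      using assms(1)
      by (simp add: X_def sum.distrib card_sign_vectors flip: sum_divide_distrib)
    also have "\<dots> \<le> (?n * (a - 1) + ?n) / l"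
      using * l by (intro divide_right_mono) auto
    also have "\<dots> = ?n * (a / l)" by (simp add: field_simps)
    finally show "(\<Sum>\<sigma>\<in>sign_vectors I. X \<sigma>) \<le> ?n * (R * sqrt (2 * \<Lambda>))"
      by (simp add: al)
  qed
qed

text \<open>Chaining: \<open>\<pi> j f\<close> is the approximation of \<open>f\<close> in the \<open>j\<close>-th net.\<close>

lemma chaining:
  fixes \<pi> :: "nat \<Rightarrow> ('i \<Rightarrow> real) \<Rightarrow> 'i \<Rightarrow> real"
  assumes I: "finite I"
    and r: "\<And>j. r j > 0" "\<And>j. r (Suc j) \<le> r j" and \<Lambda>: "\<And>j. \<Lambda> j > 0" "\<And>j. \<Lambda> j \<le> \<Lambda> (Suc j)"
    and V: "\<And>j. finite (V j)" "\<And>j. real (card (V j)) \<le> exp (\<Lambda> j)"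
    and \<pi>: "\<And>j f. f \<in> F \<Longrightarrow> \<pi> j f \<in> V j" "\<And>f. f \<in> F \<Longrightarrow> \<pi> 0 f = v0"
      "\<And>j f. f \<in> F \<Longrightarrow> L2_set (\<lambda>i. f i - \<pi> j f i) I \<le> r j"
  shows "rademacher_le I F ((\<Sum>j<J. 4 * r j * sqrt (\<Lambda> (Suc j))) + r J * sqrt (card I))"
proof -
  have links: "rademacher_le I (\<pi> J ` F) (\<Sum>j<J. 4 * r j * sqrt (\<Lambda> (Suc j)))" for J
  proof (induction J)
    case 0
    show ?case
      by (rule rademacher_le_subset[OF rademacher_le_singleton[OF I, of v0]]) (use \<pi>(2) in auto)
  next
    case (Suc J)
    \<comment> \<open>The links between consecutive approximations form a finite class: pairs from
      both nets number at most \<open>exp (2 * \<Lambda> (Suc J))\<close>, and the triangle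
      inequality through \<open>f\<close> gives radius \<open>r J + r (Suc J)\<close>, at most
      \<open>2 * r J\<close>. The finite class bound then gives
      \<open>2 * r J * sqrt (4 * \<Lambda> (Suc J))\<close>, whence the factor 4.\<close>
    define D where "D = (\<lambda>f i. \<pi> (Suc J) f i - \<pi> J f i) ` F"
    have sub: "D \<subseteq> (\<lambda>(u, v) i. u i - v i) ` (V (Suc J) \<times> V J)"
      using \<pi>(1) by (force simp: D_def)
    have fin: "finite D" using sub V(1) finite_subset by (metis finite_SigmaI finite_imageI)
    have "card D \<le> card (V (Suc J) \<times> V J)"
      using sub V(1) by (meson card_image_le card_mono finite_SigmaI finite_imageI order_trans)
    then have "real (card D) \<le> real (card (V (Suc J))) * real (card (V J))"
      by (metis card_cartesian_product of_nat_le_iff of_nat_mult)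
    also have "\<dots> \<le> exp (\<Lambda> (Suc J)) * exp (\<Lambda> (Suc J))"
      using V(2)[of "Suc J"] V(2)[of J] \<Lambda>(2)[of J]
      by (intro mult_mono) (auto intro: order_trans)
    finally have card: "real (card D) \<le> exp (2 * \<Lambda> (Suc J))"
      by (simp flip: exp_add)
    have rad: "L2_set d I \<le> 2 * r J" if "d \<in> D" for d
    proof -
      obtain f where f: "f \<in> F" "d = (\<lambda>i. \<pi> (Suc J) f i - \<pi> J f i)"
        using \<open>d \<in> D\<close> unfolding D_def by blast
      have "L2_set d I = L2_set (\<lambda>i. (f i - \<pi> J f i) + (\<pi> (Suc J) f i - f i)) I"
        by (simp add: f(2))
      also have "\<dots> \<le> L2_set (\<lambda>i. f i - \<pi> J f i) I + L2_set (\<lambda>i. \<pi> (Suc J) f i - f i) I"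
        by (rule L2_set_triangle_ineq)
      also have "L2_set (\<lambda>i. \<pi> (Suc J) f i - f i) I = L2_set (\<lambda>i. f i - \<pi> (Suc J) f i) I"
        by (simp add: L2_set_def power2_commute)
      finally show ?thesis using \<pi>(3)[OF f(1), of J] \<pi>(3)[OF f(1), of "Suc J"] r(2)[of J] by linarith
    qed
    have "rademacher_le I D (2 * r J * sqrt (2 * (2 * \<Lambda> (Suc J))))"
      by (rule massart[OF I fin _ _ card rad]) (use r(1) \<Lambda>(1) in auto)
    moreover have "sqrt (4 * \<Lambda> (Suc J)) = 2 * sqrt (\<Lambda> (Suc J))"
      by (simp add: real_sqrt_mult)
    ultimately have D: "rademacher_le I D (4 * r J * sqrt (\<Lambda> (Suc J)))"
      by (simp add: mult.assoc mult.left_commute)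
    show ?case
    proof (rule rademacher_le_subset[OF rademacher_le_add[OF Suc D]])
      fix g assume "g \<in> \<pi> (Suc J) ` F"
      then obtain f where f: "f \<in> F" "g = \<pi> (Suc J) f" by auto
      then have "(\<lambda>i. \<pi> J f i + (\<pi> (Suc J) f i - \<pi> J f i))
          \<in> {\<lambda>i. u i + v i |u v. u \<in> \<pi> J ` F \<and> v \<in> D}"
        unfolding D_def
        by (intro CollectI exI[of _ "\<pi> J f"] exI[of _ "\<lambda>i. \<pi> (Suc J) f i - \<pi> J f i"] conjI)
          (auto intro: imageI)
      then show "\<exists>k\<in>{\<lambda>i. u i + v i |u v. u \<in> \<pi> J ` F \<and> v \<in> D}. \<forall>i\<in>I. g i = k i"
        by (rule bexI[rotated]) (simp add: f)
    qed simp
  qed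
  \<comment> \<open>What remains beyond the last net may be infinite, so only its radius is
    used.\<close>
  define E where "E = (\<lambda>f i. f i - \<pi> J f i) ` F"
  have E: "rademacher_le I E (r J * sqrt (card I))"
    by (rule rademacher_le_radius[OF I]) (use \<pi>(3) in \<open>auto simp: E_def\<close>)
  show ?thesis
  proof (rule rademacher_le_subset[OF rademacher_le_add[OF links[of J] E]])
    fix f assume f: "f \<in> F"
    then have "(\<lambda>i. \<pi> J f i + (f i - \<pi> J f i)) \<in> {\<lambda>i. u i + v i |u v. u \<in> \<pi> J ` F \<and> v \<in> E}"
      unfolding E_def
      by (intro CollectI exI[of _ "\<pi> J f"] exI[of _ "\<lambda>i. f i - \<pi> J f i"] conjI)
        (auto intro: imageI)
    then show "\<exists>k\<in>{\<lambda>i. u i + v i |u v. u \<in> \<pi> J ` F \<and> v \<in> E}. \<forall>i\<in>I. f i = k i"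
      by (rule bexI[rotated]) simp
  qed simp
qed

section \<open>Maxima of decreasing curves\<close>

text \<open>All coordinates decrease together, so the l1 distance of two points of the curve is the
  difference of their coordinate sums \<open>\<psi>\<close>. Bins of width \<open>\<gamma>\<close>
  for \<open>\<psi>\<close> thus give an l1 net, which is an l2 net because each coordinate differs
  by at most \<open>M\<close>. The count depends on the range of \<open>\<psi>\<close>, not on the
  number of points of the curve.\<close>

lemma card_net_of_antimono_curves:
  fixes e :: "'i \<Rightarrow> nat \<Rightarrow> real" and M \<gamma> :: real
  assumes I: "finite I"
    and e: "\<And>i s. i \<in> I \<Longrightarrow> s \<le> t \<Longrightarrow> 0 \<le> e i s \<and> e i s \<le> M"
    and anti: "\<And>i s s'. i \<in> I \<Longrightarrow> s \<le> s' \<Longrightarrow> s' \<le> t \<Longrightarrow> e i s' \<le> e i s"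
    and \<gamma>: "\<gamma> > 0" and M: "M \<ge> 0"
  shows "\<exists>A. A \<subseteq> {..t} \<and> real (card A) \<le> card I * M / \<gamma> + 1 \<and>
    (\<forall>s\<le>t. \<exists>a\<in>A. (\<Sum>i\<in>I. (e i s - e i a)\<^sup>2) \<le> M * \<gamma>)"
proof -
  define \<psi> where "\<psi> = (\<lambda>s. \<Sum>i\<in>I. e i s)"
  define g where "g = (\<lambda>s. nat \<lfloor>\<psi> s / \<gamma>\<rfloor>)"
  \<comment> \<open>One representative per visited bin makes the net consist of points of the curve
    itself, recorded by their indices.\<close>
  define pick where "pick = (\<lambda>k. SOME s. s \<le> t \<and> g s = k)"
  define A where "A = pick ` g ` {..t}"
  have pick: "pick (g s) \<le> t \<and> g (pick (g s)) = g s" if "s \<le> t" for s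
    unfolding pick_def by (rule someI[of _ s]) (use that in auto)
  have \<psi>: "0 \<le> \<psi> s" "\<psi> s \<le> card I * M" if "s \<le> t" for s
    using e that sum_bounded_above[of I "\<lambda>i. e i s" M] by (auto simp: \<psi>_def intro!: sum_nonneg)
  have "g ` {..t} \<subseteq> {..nat \<lfloor>card I * M / \<gamma>\<rfloor>}"
    using \<psi> \<gamma> by (auto simp: g_def intro!: nat_mono floor_mono divide_right_mono)
  then have "card (g ` {..t}) \<le> nat \<lfloor>card I * M / \<gamma>\<rfloor> + 1"
    using card_mono[of "{..nat \<lfloor>card I * M / \<gamma>\<rfloor>}"] by fastforce
  then have "card A \<le> nat \<lfloor>card I * M / \<gamma>\<rfloor> + 1"
    unfolding A_def by (meson card_image_le finite_atMost finite_imageI order_trans)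
  then have "real (card A) \<le> real (nat \<lfloor>card I * M / \<gamma>\<rfloor> + 1)"
    by (simp only: of_nat_le_iff)
  also have "\<dots> \<le> card I * M / \<gamma> + 1"
    using M \<gamma> by simp
  finally have card: "real (card A) \<le> card I * M / \<gamma> + 1" .
  have close: "(\<Sum>i\<in>I. (e i s - e i a)\<^sup>2) \<le> M * \<gamma>"
    if "s \<le> t" "a \<le> t" "g a = g s" for s a
  proof -
    have abs_sum: "(\<Sum>i\<in>I. \<bar>e i s - e i a\<bar>) = \<bar>\<psi> s - \<psi> a\<bar>"
    proof (cases "s \<le> a")
      case True
      then have "(\<Sum>i\<in>I. \<bar>e i s - e i a\<bar>) = (\<Sum>i\<in>I. e i s - e i a)"
        using anti that by (intro sum.cong) auto
      moreover have "(\<Sum>i\<in>I. e i s - e i a) \<ge> 0"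
        using anti that True by (intro sum_nonneg) auto
      ultimately show ?thesis by (simp add: \<psi>_def sum_subtractf)
    next
      case False
      then have "(\<Sum>i\<in>I. \<bar>e i s - e i a\<bar>) = (\<Sum>i\<in>I. e i a - e i s)"
        using anti that by (intro sum.cong) auto
      moreover have "(\<Sum>i\<in>I. e i a - e i s) \<ge> 0"
        using anti that False by (intro sum_nonneg) auto
      ultimately show ?thesis by (simp add: \<psi>_def sum_subtractf)
    qed
    have "\<lfloor>\<psi> a / \<gamma>\<rfloor> = \<lfloor>\<psi> s / \<gamma>\<rfloor>"
      using that(3) \<psi>(1)[OF that(1)] \<psi>(1)[OF that(2)] \<gamma> unfolding g_def
      by (metis divide_nonneg_pos eq_nat_nat_iff zero_le_floor)
    then have "\<bar>\<psi> s / \<gamma> - \<psi> a / \<gamma>\<bar> \<le> 1" by linarith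
    then have "\<bar>\<psi> s - \<psi> a\<bar> \<le> \<gamma>" using \<gamma> by (simp add: field_simps flip: diff_divide_distrib)
    then have "M * (\<Sum>i\<in>I. \<bar>e i s - e i a\<bar>) \<le> M * \<gamma>"
      using M by (simp add: abs_sum mult_left_mono)
    moreover have "(e i s - e i a)\<^sup>2 \<le> M * \<bar>e i s - e i a\<bar>" if "i \<in> I" for i
    proof -
      have "\<bar>e i s - e i a\<bar> \<le> M"
        using e[OF \<open>i \<in> I\<close> \<open>s \<le> t\<close>] e[OF \<open>i \<in> I\<close> \<open>a \<le> t\<close>] by linarith
      then have "\<bar>e i s - e i a\<bar> * \<bar>e i s - e i a\<bar> \<le> M * \<bar>e i s - e i a\<bar>"
        by (intro mult_right_mono) auto
      then show ?thesis by (simp add: power2_eq_square)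
    qed
    then have "(\<Sum>i\<in>I. (e i s - e i a)\<^sup>2) \<le> (\<Sum>i\<in>I. M * \<bar>e i s - e i a\<bar>)"
      by (intro sum_mono) auto
    ultimately show ?thesis by (simp add: sum_distrib_left)
  qed
  have "A \<subseteq> {..t}" using pick by (auto simp: A_def)
  moreover have "\<forall>s\<le>t. \<exists>a\<in>A. (\<Sum>i\<in>I. (e i s - e i a)\<^sup>2) \<le> M * \<gamma>"
    using close pick unfolding A_def by blast
  ultimately show ?thesis using card by blast
qed

lemma abs_Max_diff_le:
  fixes f g :: "'k \<Rightarrow> real"
  assumes "finite K" "K \<noteq> {}" "\<And>k. k \<in> K \<Longrightarrow> \<bar>f k - g k\<bar> \<le> c"
  shows "\<bar>Max (f ` K) - Max (g ` K)\<bar> \<le> c"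
proof -
  have le: "Max (f ` K) \<le> Max (g ` K) + c" if "\<forall>k\<in>K. f k \<le> g k + c" for f g :: "'k \<Rightarrow> real"
  proof -
    have "f k \<le> Max (g ` K) + c" if "k \<in> K" for k
    proof -
      have "g k \<le> Max (g ` K)" using assms(1) that by (intro Max_ge) auto
      then show ?thesis using \<open>\<forall>k\<in>K. f k \<le> g k + c\<close> that by force
    qed
    then show ?thesis using assms(1,2) by simp
  qed
  have "\<forall>k\<in>K. f k \<le> g k + c" "\<forall>k\<in>K. g k \<le> f k + c" using assms(3) by (force simp: abs_le_iff)+
  then show ?thesis using le[of f g] le[of g f] by (simp add: abs_le_iff)
qed

text \<open>The witness is \<open>a k = Max {s. S s \<ge> k \<delta>}\<close>; \<open>S 0 = B\<close> keeps this set nonempty.\<close>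

lemma Max_rounding:
  fixes S :: "nat \<Rightarrow> real" and B :: real
  assumes B: "B > 0" and m: "m > 0" and S: "\<And>s. s \<le> t \<Longrightarrow> 0 \<le> S s \<and> S s \<le> B" and "S 0 = B"
  shows "\<exists>a. (\<forall>k\<le>m. a k \<le> t) \<and> (\<forall>e. (\<forall>s s'. s \<le> s' \<longrightarrow> s' \<le> t \<longrightarrow> e s' \<le> e s) \<longrightarrow>
     \<bar>Max ((\<lambda>s. S s - e s) ` {..t}) - Max ((\<lambda>k. real k * (B / m) - e (a k)) ` {..m})\<bar> \<le> B / m)"
proof -
  define \<delta> where "\<delta> = B / m"
  have \<delta>: "\<delta> > 0" "m * \<delta> = B" using B m by (auto simp: \<delta>_def)
  \<comment> \<open>The index depends on \<open>S\<close> and \<open>k\<close> but not on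
    \<open>e\<close>, so one choice serves the curves of all sample points; this is what makes
    counting the choices meaningful.\<close>
  define a where "a = (\<lambda>k. Max {s. s \<le> t \<and> real k * \<delta> \<le> S s})"
  have fin: "finite {s. s \<le> t \<and> real k * \<delta> \<le> S s}" for k by simp
  have a: "a k \<le> t \<and> real k * \<delta> \<le> S (a k)" if "k \<le> m" for k
  proof -
    have "real k * \<delta> \<le> m * \<delta>" using that \<delta> by (intro mult_right_mono) auto
    then have "0 \<in> {s. s \<le> t \<and> real k * \<delta> \<le> S s}" using \<delta> \<open>S 0 = B\<close> by simp
    then have "a k \<in> {s. s \<le> t \<and> real k * \<delta> \<le> S s}"
      unfolding a_def by (intro Max_in fin) auto
    then show ?thesis by simp
  qed
  have "\<bar>Max ((\<lambda>s. S s - e s) ` {..t}) - Max ((\<lambda>k. real k * \<delta> - e (a k)) ` {..m})\<bar> \<le> \<delta>"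
    if e: "\<forall>s s'. s \<le> s' \<longrightarrow> s' \<le> t \<longrightarrow> e s' \<le> e s" for e
  proof -
    let ?F = "Max ((\<lambda>s. S s - e s) ` {..t})" and ?G = "Max ((\<lambda>k. real k * \<delta> - e (a k)) ` {..m})"
    have "real k * \<delta> - e (a k) \<le> ?F" if "k \<le> m" for k
    proof -
      have "S (a k) - e (a k) \<le> ?F" using a[OF that] by (intro Max_ge) auto
      then show ?thesis using a[OF that] by linarith
    qed
    then have "?G \<le> ?F" by simp
    moreover have "S s - e s \<le> ?G + \<delta>" if s: "s \<le> t" for s
    proof -
      \<comment> \<open>\<open>S s\<close> is rounded down to \<open>k * \<delta>\<close>, losing at
        most \<open>\<delta>\<close>. As \<open>a k\<close> is the last index reaching that level,
        it is not before \<open>s\<close>, and \<open>e\<close> is no larger there.\<close>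
      define k where "k = nat \<lfloor>S s / \<delta>\<rfloor>"
      have k: "real k \<le> S s / \<delta>" "S s / \<delta> \<le> real k + 1"
        using S[OF s] \<delta> by (auto simp: k_def)
      have "S s / \<delta> \<le> m" using S[OF s] \<delta> by (simp add: field_simps)
      then have "k \<le> m" using k by linarith
      have k': "real k * \<delta> \<le> S s" "S s \<le> real k * \<delta> + \<delta>"
        using k \<delta> by (auto simp: field_simps)
      have "s \<le> a k" unfolding a_def using k' s by (intro Max_ge fin) auto
      then have "e (a k) \<le> e s" using e a[OF \<open>k \<le> m\<close>] by auto
      moreover have "real k * \<delta> - e (a k) \<le> ?G" using \<open>k \<le> m\<close> by (intro Max_ge) auto
      ultimately show ?thesis using k' by linarith
    qed
    then have "?F \<le> ?G + \<delta>" by simp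
    ultimately show ?thesis using \<delta> by linarith
  qed
  with a show ?thesis unfolding \<delta>_def by blast
qed

section \<open>Entropy and Rademacher average of a class of maxima\<close>

lemma power2_le_if_abs_le: "\<bar>x\<bar> \<le> y \<Longrightarrow> x\<^sup>2 \<le> y\<^sup>2" for x y :: real
  using power_mono[of "\<bar>x\<bar>" y 2] by simp

lemma L2_set_le_iff: "r \<ge> 0 \<Longrightarrow> L2_set f A \<le> r \<longleftrightarrow> (\<Sum>i\<in>A. (f i)\<^sup>2) \<le> r\<^sup>2"
  unfolding L2_set_def by (metis real_le_lsqrt real_sqrt_le_iff real_sqrt_unique)

text \<open>In the application \<open>e i s\<close> is the truncated demand of sample point
  \<open>i\<close> accumulated from period \<open>s\<close> on, \<open>B\<close> the largest
  base-stock level and \<open>\<phi>\<close> the one-period cost.\<close>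

locale antimono_curves =
  fixes I :: "'i set" and e :: "'i \<Rightarrow> nat \<Rightarrow> real" and t :: nat and B :: real and \<phi> :: "real \<Rightarrow> real"
  assumes I: "finite I" and B: "B > 0"
    and e: "\<And>i s. i \<in> I \<Longrightarrow> s \<le> t \<Longrightarrow> 0 \<le> e i s \<and> e i s \<le> 2 * B"
    and anti: "\<And>i s s'. i \<in> I \<Longrightarrow> s \<le> s' \<Longrightarrow> s' \<le> t \<Longrightarrow> e i s' \<le> e i s"
    and \<phi>: "\<And>x y. \<bar>\<phi> x - \<phi> y\<bar> \<le> \<bar>x - y\<bar>"
begin

definition envelope :: "(nat \<Rightarrow> real) \<Rightarrow> 'i \<Rightarrow> real" where
  "envelope S i = \<phi> (Max ((\<lambda>s. S s - e i s) ` {..t}))"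

definition levels :: "(nat \<Rightarrow> real) set" where
  "levels = {S. (\<forall>s\<le>t. 0 \<le> S s \<and> S s \<le> B) \<and> S 0 = B}"

text \<open>Two errors of size \<open>B / m\<close> per coordinate (in quadratic mean) add up to the
  radius: one from rounding the levels, one from moving the \<open>m + 1\<close> indices to a net on
  the curve. The set \<open>V\<close> consists of all functions obtained from \<open>m + 1\<close>
  net indices, which explains the exponent.\<close>

lemma net:
  assumes m: "m > 0"
  shows "\<exists>V. finite V \<and> real (card V) \<le> (9 * real m ^ 3) ^ (m + 1) \<and>
    (\<forall>S\<in>levels. \<exists>v\<in>V. L2_set (\<lambda>i. envelope S i - v i) I \<le> 2 * (B / m) * sqrt (card I))"
proof (cases "I = {}")
  case True
  have "1 \<le> 9 * real m ^ 3" using m by (simp add: one_le_power order_trans[OF _ mult_right_mono[of 1 9]])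
  then have "1 \<le> (9 * real m ^ 3) ^ (m + 1)" by (rule one_le_power)
  then show ?thesis
    using True by (intro exI[of _ "{\<lambda>_. 0}"]) simp
next
  case False
  define n where "n = real (card I)"
  have n: "n > 0" using False I by (simp add: n_def card_gt_0_iff)
  define \<delta> where "\<delta> = B / m"
  have \<delta>: "\<delta> > 0" using B m by (simp add: \<delta>_def)
  \<comment> \<open>Chosen so that \<open>m + 1\<close> squared errors of
    \<open>2 * B * \<gamma>\<close> sum to exactly \<open>\<delta> ^ 2 * n\<close>.\<close>
  define \<gamma> :: real where "\<gamma> = n * B / (2 * real m ^ 2 * real (m + 1))"
  have \<gamma>: "\<gamma> > 0" unfolding \<gamma>_def using n B m
    by (intro divide_pos_pos mult_pos_pos zero_less_power) simp_all
  obtain A where A: "A \<subseteq> {..t}" "real (card A) \<le> card I * (2 * B) / \<gamma> + 1"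
    and close: "\<And>s. s \<le> t \<Longrightarrow> \<exists>a\<in>A. (\<Sum>i\<in>I. (e i s - e i a)\<^sup>2) \<le> 2 * B * \<gamma>"
  proof -
    have "\<exists>A. A \<subseteq> {..t} \<and> real (card A) \<le> card I * (2 * B) / \<gamma> + 1 \<and>
        (\<forall>s\<le>t. \<exists>a\<in>A. (\<Sum>i\<in>I. (e i s - e i a)\<^sup>2) \<le> 2 * B * \<gamma>)"
      by (rule card_net_of_antimono_curves) (use I B \<gamma> e anti in auto)
    then show ?thesis using that by blast
  qed
  define V where "V = (\<lambda>a i. \<phi> (Max ((\<lambda>k. real k * \<delta> - e i (a k)) ` {..m}))) ` PiE {..m} (\<lambda>_. A)"
  have finA: "finite A" using A(1) finite_subset by blast
  have "real (card A) \<le> 4 * real m ^ 2 * (m + 1) + 1"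
  proof -
    have "n * (2 * B) / (n * B / (2 * p * q)) = 4 * p * q" if "p > 0" "q > 0" for p q :: real
      using n B that by (simp add: field_simps)
    from this[of "real m ^ 2" "real (m + 1)"] show ?thesis
      using A(2) m by (simp add: \<gamma>_def flip: n_def)
  qed
  \<comment> \<open>The left-hand side is \<open>4 * m ^ 3 + 4 * m ^ 2 + 1\<close>, and each power
    of \<open>m\<close> is at most \<open>m ^ 3\<close>.\<close>
  also have "\<dots> \<le> 9 * real m ^ 3"
  proof -
    have "real m ^ 2 \<le> real m ^ 3" "1 \<le> real m ^ 3" using m by (auto intro: power_increasing one_le_power)
    then show ?thesis by (simp add: algebra_simps power2_eq_square power3_eq_cube)
  qed
  finally have cardA: "real (card A) \<le> 9 * real m ^ 3" .
  have "card V \<le> card (PiE {..m} (\<lambda>_. A))"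
    unfolding V_def using finA by (intro card_image_le finite_PiE) auto
  also have "\<dots> = card A ^ (m + 1)" by (simp add: card_PiE)
  finally have "real (card V) \<le> real (card A) ^ (m + 1)" by (metis of_nat_le_iff of_nat_power)
  also have "\<dots> \<le> (9 * real m ^ 3) ^ (m + 1)" by (intro power_mono cardA) simp
  finally have cardV: "real (card V) \<le> (9 * real m ^ 3) ^ (m + 1)" .
  have "\<exists>v\<in>V. L2_set (\<lambda>i. envelope S i - v i) I \<le> 2 * \<delta> * sqrt (card I)" if S: "S \<in> levels" for S
  proof -
    obtain a where a: "\<And>k. k \<le> m \<Longrightarrow> a k \<le> t"
      and round: "\<And>e. (\<forall>s s'. s \<le> s' \<longrightarrow> s' \<le> t \<longrightarrow> e s' \<le> e s) \<Longrightarrow>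
        \<bar>Max ((\<lambda>s. S s - e s) ` {..t}) - Max ((\<lambda>k. real k * \<delta> - e (a k)) ` {..m})\<bar> \<le> \<delta>"
      using Max_rounding[OF B m, where t = t and S = S] S unfolding levels_def \<delta>_def by blast
    have "\<forall>k\<in>{..m}. \<exists>b\<in>A. (\<Sum>i\<in>I. (e i (a k) - e i b)\<^sup>2) \<le> 2 * B * \<gamma>"
      using close a by auto
    then obtain b0 where b0: "\<And>k. k \<le> m \<Longrightarrow> b0 k \<in> A \<and> (\<Sum>i\<in>I. (e i (a k) - e i (b0 k))\<^sup>2) \<le> 2 * B * \<gamma>"
      by (metis atMost_iff)
    define b where "b = restrict b0 {..m}"
    have b: "b \<in> PiE {..m} (\<lambda>_. A)"
      "\<And>k. k \<le> m \<Longrightarrow> (\<Sum>i\<in>I. (e i (a k) - e i (b k))\<^sup>2) \<le> 2 * B * \<gamma>"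
      using b0 by (auto simp: b_def)
    define F1 where "F1 = (\<lambda>i. Max ((\<lambda>k. real k * \<delta> - e i (a k)) ` {..m}))"
    define F2 where "F2 = (\<lambda>i. Max ((\<lambda>k. real k * \<delta> - e i (b k)) ` {..m}))"
    have vV: "(\<lambda>i. \<phi> (F2 i)) \<in> V" using b(1) unfolding V_def F2_def by blast
    have d1: "L2_set (\<lambda>i. envelope S i - \<phi> (F1 i)) I \<le> \<delta> * sqrt n"
    proof -
      have "\<bar>envelope S i - \<phi> (F1 i)\<bar> \<le> \<delta>" if "i \<in> I" for i
        using round[of "e i"] anti[OF that] \<phi> unfolding envelope_def F1_def by (meson order_trans)
      then have "L2_set (\<lambda>i. envelope S i - \<phi> (F1 i)) I \<le> L2_set (\<lambda>i. \<delta>) I"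
        unfolding L2_set_def by (intro real_sqrt_le_mono sum_mono power2_le_if_abs_le)
      then show ?thesis using \<delta> by (simp add: L2_set_constant n_def mult.commute)
    qed
    have d2: "L2_set (\<lambda>i. \<phi> (F1 i) - \<phi> (F2 i)) I \<le> \<delta> * sqrt n"
    proof -
      \<comment> \<open>The uniform norm over \<open>k\<close> is replaced by the Euclidean one,
        since the closeness of net points is known only after summing over \<open>i\<close>; the two
        sums can then be exchanged.\<close>
      have pt: "(\<phi> (F1 i) - \<phi> (F2 i))\<^sup>2 \<le> (\<Sum>k\<le>m. (e i (a k) - e i (b k))\<^sup>2)" for i
      proof -
        define c where "c = sqrt (\<Sum>k\<le>m. (e i (a k) - e i (b k))\<^sup>2)"
        have "\<bar>e i (a k) - e i (b k)\<bar> \<le> c" if "k \<le> m" for k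
          unfolding c_def using that
          by (intro real_le_rsqrt) (auto intro!: member_le_sum[where f = "\<lambda>k. (e i (a k) - e i (b k))\<^sup>2"])
        then have "\<bar>F1 i - F2 i\<bar> \<le> c"
          unfolding F1_def F2_def by (intro abs_Max_diff_le) (auto simp: abs_minus_commute)
        then have "\<bar>\<phi> (F1 i) - \<phi> (F2 i)\<bar> \<le> c" using \<phi> order_trans by blast
        then have "(\<phi> (F1 i) - \<phi> (F2 i))\<^sup>2 \<le> c\<^sup>2" by (rule power2_le_if_abs_le)
        also have "c\<^sup>2 = (\<Sum>k\<le>m. (e i (a k) - e i (b k))\<^sup>2)" unfolding c_def by (simp add: sum_nonneg)
        finally show ?thesis .
      qed
      have "(\<Sum>i\<in>I. (\<phi> (F1 i) - \<phi> (F2 i))\<^sup>2) \<le> (\<Sum>i\<in>I. \<Sum>k\<le>m. (e i (a k) - e i (b k))\<^sup>2)"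
        by (intro sum_mono pt)
      also have "\<dots> = (\<Sum>k\<le>m. \<Sum>i\<in>I. (e i (a k) - e i (b k))\<^sup>2)" by (rule sum.swap)
      also have "\<dots> \<le> (\<Sum>k\<le>m. 2 * B * \<gamma>)" by (intro sum_mono b(2)) auto
      also have "\<dots> = (\<delta> * sqrt n)\<^sup>2"
        using n m by (simp add: \<gamma>_def \<delta>_def power_mult_distrib power_divide)
          (simp add: field_simps power2_eq_square)
      finally show ?thesis using \<delta> n by (subst L2_set_le_iff) auto
    qed
    have "L2_set (\<lambda>i. envelope S i - \<phi> (F2 i)) I
        = L2_set (\<lambda>i. (envelope S i - \<phi> (F1 i)) + (\<phi> (F1 i) - \<phi> (F2 i))) I" by simp
    also have "\<dots> \<le> L2_set (\<lambda>i. envelope S i - \<phi> (F1 i)) I + L2_set (\<lambda>i. \<phi> (F1 i) - \<phi> (F2 i)) I"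
      by (rule L2_set_triangle_ineq)
    also have "\<dots> \<le> 2 * \<delta> * sqrt n" using d1 d2 by simp
    finally show ?thesis using vV unfolding n_def by (rule bexI)
  qed
  moreover have "finite V" unfolding V_def using finA by (intro finite_imageI finite_PiE) auto
  ultimately show ?thesis using cardV unfolding \<delta>_def by blast
qed

text \<open>This is the net at scale zero: index \<open>0\<close> keeps the maximum above
  \<open>- B\<close>, so the single constant vector \<open>\<phi> 0\<close> approximates the whole
  class.\<close>

lemma envelope_radius:
  assumes "S \<in> levels"
  shows "L2_set (\<lambda>i. envelope S i - \<phi> 0) I \<le> 2 * B * sqrt (card I)"
proof -
  have "\<bar>envelope S i - \<phi> 0\<bar> \<le> 2 * B" if "i \<in> I" for i
  proof -
    have bd: "S s - e i s \<le> B" "- (2 * B) \<le> S s - e i s" if "s \<le> t" for s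
      using e[OF \<open>i \<in> I\<close> that] assms that by (auto simp: levels_def intro: order_trans)
    have "Max ((\<lambda>s. S s - e i s) ` {..t}) \<le> B" using bd by simp
    moreover have "S 0 - e i 0 \<le> Max ((\<lambda>s. S s - e i s) ` {..t})" by (intro Max_ge) auto
    ultimately have "\<bar>Max ((\<lambda>s. S s - e i s) ` {..t}) - 0\<bar> \<le> 2 * B" using bd(2)[of 0] B by linarith
    then show ?thesis unfolding envelope_def using \<phi> order_trans by blast
  qed
  then have "L2_set (\<lambda>i. envelope S i - \<phi> 0) I \<le> L2_set (\<lambda>i. 2 * B) I"
    unfolding L2_set_def by (intro real_sqrt_le_mono sum_mono power2_le_if_abs_le)
  then show ?thesis using B by (simp add: L2_set_constant mult.commute)
qed

lemma rademacher_le_envelope: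
  "rademacher_le I (envelope ` levels) (386 * B * sqrt (card I))"
proof (cases "I = {}")
  case True
  show ?thesis
    by (rule rademacher_le_subset[OF rademacher_le_singleton[OF I, of "\<lambda>_. 0"]]) (use True B in auto)
next
  case False
  define n where "n = card I"
  have n: "n > 0" using False I by (simp add: n_def card_gt_0_iff)
  define r where "r = (\<lambda>j. 2 * (B / 2 ^ j) * sqrt n)"
  \<comment> \<open>The true entropy is of order \<open>j * 2 ^ j\<close>. Replacing it by a
    multiple of \<open>3 ^ j\<close> absorbs the factor \<open>j\<close> while
    \<open>sqrt 3 / 2 < 1\<close> keeps the chaining sum geometric.\<close>
  define \<Lambda> where "\<Lambda> = (\<lambda>j. 12 * 3 ^ j :: real)"
  have entropy: "(9 * real (2 ^ j) ^ 3) ^ (2 ^ j + 1) \<le> exp (\<Lambda> j)" for j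
  proof -
    have "9 * real (2 ^ j) ^ 3 \<le> 2 ^ (3 * j + 4)"
      by (simp add: power_add mult.commute[of 3] flip: power_mult)
    also have "\<dots> \<le> exp 1 ^ (3 * j + 4)"
      using exp_ge_add_one_self[of 1] by (intro power_mono) auto
    also have "\<dots> = exp (3 * real j + 4)" by (simp flip: exp_of_nat_mult)
    finally have "(9 * real (2 ^ j) ^ 3) ^ (2 ^ j + 1) \<le> exp (3 * real j + 4) ^ (2 ^ j + 1)"
      by (intro power_mono) auto
    also have "\<dots> = exp (real (2 ^ j + 1) * (3 * real j + 4))" by (simp only: exp_of_nat_mult)
    also have "real (2 ^ j + 1) * (3 * real j + 4) \<le> (2 * 2 ^ j) * (6 * (3 / 2) ^ j)"
    proof (intro mult_mono)
      show "3 * real j + 4 \<le> 6 * (3 / 2) ^ j"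
      proof (induction j)
        case (Suc j)
        \<comment> \<open>Multiplying \<open>3 * j + 4\<close> by \<open>3 / 2\<close> gains the
          required 3 only for \<open>j \<ge> 1\<close>; for \<open>j = 0\<close> the claim reads
          \<open>7 \<le> 9\<close>.\<close>
        then show ?case by (cases j) auto
      qed simp
    qed auto
    also have "\<dots> = \<Lambda> j" by (simp add: \<Lambda>_def power_divide)
    finally show ?thesis by simp
  qed
  \<comment> \<open>At \<open>j = 0\<close> the net is forced to be one common vector, from which
    every chain starts.\<close>
  define good where "good = (\<lambda>j V. finite V \<and> real (card V) \<le> exp (\<Lambda> j) \<and>
    (j = 0 \<longrightarrow> V = {\<lambda>_. \<phi> 0}) \<and> (\<forall>f\<in>envelope ` levels. \<exists>v\<in>V. L2_set (\<lambda>i. f i - v i) I \<le> r j))"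
  have "\<exists>V. good j V" for j
  proof (cases "j = 0")
    case True
    then show ?thesis
      using envelope_radius by (intro exI[of _ "{\<lambda>_. \<phi> 0}"]) (auto simp: good_def r_def \<Lambda>_def n_def)
  next
    case False
    obtain V where "finite V" "real (card V) \<le> (9 * real (2 ^ j) ^ 3) ^ (2 ^ j + 1)"
      "\<forall>S\<in>levels. \<exists>v\<in>V. L2_set (\<lambda>i. envelope S i - v i) I \<le> 2 * (B / real (2 ^ j)) * sqrt (card I)"
      using net[of "2 ^ j"] by auto
    moreover have "real (card V) \<le> exp (\<Lambda> j)" using calculation(2) entropy[of j] by (rule order_trans)
    ultimately show ?thesis using False
      by (intro exI[of _ V]) (simp add: good_def r_def n_def)
  qed
  then obtain V where "\<And>j. good j (V j)" by metis
  then have V: "\<And>j. finite (V j)" "\<And>j. real (card (V j)) \<le> exp (\<Lambda> j)" "V 0 = {\<lambda>_. \<phi> 0}"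
      "\<And>j f. f \<in> envelope ` levels \<Longrightarrow> \<exists>v\<in>V j. L2_set (\<lambda>i. f i - v i) I \<le> r j"
    unfolding good_def by blast+
  define \<pi> where "\<pi> = (\<lambda>j f. SOME v. v \<in> V j \<and> L2_set (\<lambda>i. f i - v i) I \<le> r j)"
  have \<pi>: "\<pi> j f \<in> V j \<and> L2_set (\<lambda>i. f i - \<pi> j f i) I \<le> r j" if "f \<in> envelope ` levels" for j f
  proof -
    have "\<exists>v. v \<in> V j \<and> L2_set (\<lambda>i. f i - v i) I \<le> r j" using V(4)[OF that] by blast
    then show ?thesis unfolding \<pi>_def by (rule someI_ex)
  qed
  have "rademacher_le I (envelope ` levels) ((\<Sum>j<n. 4 * r j * sqrt (\<Lambda> (Suc j))) + r n * sqrt (card I))"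
  proof (rule chaining[OF I, of r \<Lambda> V "envelope ` levels" \<pi> "\<lambda>_. \<phi> 0" n])
    show "r (Suc j) \<le> r j" for j using B by (simp add: r_def field_simps)
    show "\<Lambda> j \<le> \<Lambda> (Suc j)" for j by (simp add: \<Lambda>_def)
    show "\<pi> 0 f = (\<lambda>_. \<phi> 0)" if "f \<in> envelope ` levels" for f using \<pi>[OF that, of 0] V(3) by simp
  qed (use V \<pi> B n in \<open>auto simp: r_def \<Lambda>_def\<close>)
  moreover have "(\<Sum>j<n. 4 * r j * sqrt (\<Lambda> (Suc j))) + r n * sqrt (card I) \<le> 386 * B * sqrt (card I)"
  proof -
    \<comment> \<open>Here \<open>sqrt 3 \<le> 7 / 4\<close>, and \<open>48 = 4 * 2 * 6\<close>. The
      ratio \<open>7 / 8\<close> has geometric sum at most 8, so the links contribute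
      \<open>384 = 48 * 8\<close>.\<close>
    have increment: "4 * r j * sqrt (\<Lambda> (Suc j)) \<le> 48 * B * sqrt n * (7 / 8) ^ j" for j
    proof -
      have "sqrt (\<Lambda> (Suc j)) = sqrt (36 * 3 ^ j)" by (simp add: \<Lambda>_def)
      also have "\<dots> = 6 * sqrt 3 ^ j" by (simp add: real_sqrt_mult real_sqrt_power)
      also have "\<dots> \<le> 6 * (7 / 4) ^ j"
        by (intro mult_left_mono power_mono real_le_lsqrt) (auto simp: power2_eq_square)
      finally have "4 * r j * sqrt (\<Lambda> (Suc j)) \<le> 4 * r j * (6 * (7 / 4) ^ j)"
        using B by (intro mult_left_mono) (auto simp: r_def)
      also have "\<dots> = 48 * B * sqrt n * ((7 / 4) ^ j / 2 ^ j)" by (simp add: r_def)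
      also have "(7 / 4) ^ j / 2 ^ j = (7 / 8 :: real) ^ j" by (simp flip: power_divide)
      finally show ?thesis .
    qed
    have "(\<Sum>j<n. 4 * r j * sqrt (\<Lambda> (Suc j))) \<le> (\<Sum>j<n. 48 * B * sqrt n * (7 / 8) ^ j)"
      by (intro sum_mono increment)
    also have "\<dots> = 48 * B * sqrt n * ((1 - (7 / 8) ^ n) * 8)"
      by (simp add: sum_gp_strict flip: sum_distrib_left)
    also have "\<dots> \<le> 48 * B * sqrt n * 8"
      using B by (intro mult_left_mono) auto
    finally have 1: "(\<Sum>j<n. 4 * r j * sqrt (\<Lambda> (Suc j))) \<le> 384 * B * sqrt n" by simp
    \<comment> \<open>After \<open>n = card I\<close> links the radius has shrunk by
      \<open>2 ^ n\<close>, which beats the trivial factor \<open>sqrt n\<close>; the residual adds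
      the last 2 of 386.\<close>
    have "r n * sqrt n = 2 * B * (real n / 2 ^ n)" by (simp add: r_def)
    also have "\<dots> \<le> 2 * B * sqrt n"
    proof (intro mult_left_mono)
      have "real n \<le> 2 ^ n" by (metis less_exp less_imp_le of_nat_le_iff of_nat_numeral of_nat_power)
      moreover have "1 \<le> sqrt n" using n by simp
      moreover have "real n / 2 ^ n \<le> 1" using calculation(1) by simp
      ultimately show "real n / 2 ^ n \<le> sqrt n" by linarith
    qed (use B in auto)
    finally show ?thesis using 1 by (simp add: n_def)
  qed
  ultimately show ?thesis by (rule rademacher_le_subset) auto
qed

end

section \<open>Symmetrization\<close>

text \<open>A supremum over an uncountable class need not be measurable. The countable subclass
  \<open>P0\<close>, dense for uniform distance of losses, carries all suprema that are
  integrated.\<close>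

locale bounded_loss_class = prob_space D for D :: "'d measure" +
  fixes l :: "'p \<Rightarrow> 'd \<Rightarrow> real" and P P0 :: "'p set" and B :: real and N :: nat
  assumes P0: "P0 \<subseteq> P" "countable P0" and P: "P \<noteq> {}" and N: "N > 0"
    and meas: "\<And>p. p \<in> P \<Longrightarrow> l p \<in> borel_measurable D"
    and bound: "\<And>p d. p \<in> P \<Longrightarrow> d \<in> space D \<Longrightarrow> \<bar>l p d\<bar> \<le> B"
    and dense: "\<And>p \<epsilon>. p \<in> P \<Longrightarrow> \<epsilon> > 0 \<Longrightarrow> \<exists>q\<in>P0. \<forall>d\<in>space D. \<bar>l p d - l q d\<bar> \<le> \<epsilon>"
begin

lemma P0_nonempty: "P0 \<noteq> {}"
  using P dense[of _ 1] by fastforce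

lemma integrable_l: "p \<in> P \<Longrightarrow> integrable D (l p)"
  by (rule integrable_const_bound[of _ B]) (auto intro: bound meas)

lemma abs_risk_le:
  assumes "p \<in> P"
  shows "\<bar>risk D l p\<bar> \<le> B"
proof -
  have "\<bar>risk D l p\<bar> \<le> (\<integral>d. \<bar>l p d\<bar> \<partial>D)" unfolding risk_def by (rule integral_abs_bound)
  also have "\<dots> \<le> B"
    using assms by (intro integral_le_const AE_I2) (auto intro: bound integrable_l)
  finally show ?thesis .
qed

lemma risk_dense:
  assumes "p \<in> P" "q \<in> P" "\<forall>d\<in>space D. \<bar>l p d - l q d\<bar> \<le> \<epsilon>"
  shows "\<bar>risk D l p - risk D l q\<bar> \<le> \<epsilon>"
proof -
  have "risk D l p - risk D l q = (\<integral>d. l p d - l q d \<partial>D)"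
    unfolding risk_def using assms by (simp add: integrable_l)
  also have "\<bar>\<dots>\<bar> \<le> (\<integral>d. \<bar>l p d - l q d\<bar> \<partial>D)" by (rule integral_abs_bound)
  also have "\<dots> \<le> \<epsilon>"
    using assms
    by (intro integral_le_const AE_I2 integrable_abs Bochner_Integration.integrable_diff integrable_l) auto
  finally show ?thesis .
qed

abbreviation M where "M \<equiv> samples D N"

lemma prob_space_PiM_D: "prob_space (PiM J (\<lambda>_. D))"
  by (intro prob_space_PiM prob_space_axioms)

lemma prob_space_M: "prob_space M"
  unfolding samples_def by (rule prob_space_PiM_D)

lemma space_M: "\<omega> \<in> space M \<Longrightarrow> i \<in> {1..N} \<Longrightarrow> \<omega> i \<in> space D"
  by (auto simp: samples_def space_PiM PiE_def Pi_def)

lemma measurable_l_component: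
  assumes "p \<in> P" "j \<in> J"
  shows "(\<lambda>z. l p (z j)) \<in> borel_measurable (PiM J (\<lambda>_. D))"
  using measurable_compose[OF measurable_component_singleton[OF assms(2)] meas[OF assms(1)]] .

lemma integral_l_component:
  assumes "p \<in> P" "j \<in> J"
  shows "(\<integral>z. l p (z j) \<partial>PiM J (\<lambda>_. D)) = risk D l p"
proof -
  have "risk D l p = (\<integral>d. l p d \<partial>distr (PiM J (\<lambda>_. D)) D (\<lambda>z. z j))"
    unfolding risk_def using assms(2) by (subst distr_PiM_component) (auto intro: prob_space_axioms)
  also have "\<dots> = (\<integral>z. l p (z j) \<partial>PiM J (\<lambda>_. D))"
    using assms by (intro integral_distr meas) auto
  finally show ?thesis ..
qed

lemma integrable_l_component:
  assumes "p \<in> P" "j \<in> J"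
  shows "integrable (PiM J (\<lambda>_. D)) (\<lambda>z. l p (z j))"
proof -
  interpret J: prob_space "PiM J (\<lambda>_. D)" by (rule prob_space_PiM_D)
  show ?thesis
    using assms
    by (intro J.integrable_const_bound[of _ B] measurable_l_component AE_I2)
      (auto simp: space_PiM PiE_def Pi_def intro: bound)
qed

lemma measurable_emp_risk: "p \<in> P \<Longrightarrow> (\<lambda>\<omega>. emp_risk N l \<omega> p) \<in> borel_measurable M"
  unfolding emp_risk_def samples_def
  by (intro borel_measurable_times borel_measurable_sum borel_measurable_const measurable_l_component)

lemma abs_emp_risk_le:
  assumes "p \<in> P" "\<omega> \<in> space M"
  shows "\<bar>emp_risk N l \<omega> p\<bar> \<le> B"
proof -
  have "\<bar>\<Sum>i=1..N. l p (\<omega> i)\<bar> \<le> (\<Sum>i=1..N. \<bar>l p (\<omega> i)\<bar>)" by (rule sum_abs)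
  also have "\<dots> \<le> (\<Sum>i=1..N. B)" by (intro sum_mono bound assms space_M) auto
  finally show ?thesis using N by (simp add: emp_risk_def abs_mult field_simps)
qed

lemma integrable_emp_risk: "p \<in> P \<Longrightarrow> integrable M (\<lambda>\<omega>. emp_risk N l \<omega> p)"
proof -
  interpret M: prob_space M by (rule prob_space_M)
  show "p \<in> P \<Longrightarrow> ?thesis"
    by (intro M.integrable_const_bound[of _ B] measurable_emp_risk AE_I2) (auto intro: abs_emp_risk_le)
qed

lemma integral_emp_risk:
  assumes "p \<in> P"
  shows "(\<integral>\<omega>. emp_risk N l \<omega> p \<partial>M) = risk D l p"
  using assms N unfolding emp_risk_def samples_def
  by (simp add: integral_l_component integrable_l_component)

section \<open>Supremum of the deviations and comparison with the estimation error\<close>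

lemma bdd_deviation:
  "\<omega> \<in> space M \<Longrightarrow> P' \<subseteq> P \<Longrightarrow> bdd_above ((\<lambda>p. risk D l p - emp_risk N l \<omega> p) ` P')"
proof (rule bdd_aboveI2[of _ _ "2 * B"])
  fix p assume "\<omega> \<in> space M" "P' \<subseteq> P" "p \<in> P'"
  then show "risk D l p - emp_risk N l \<omega> p \<le> 2 * B"
    using abs_risk_le[of p] abs_emp_risk_le[of p \<omega>] by force
qed

text \<open>A loss uniformly within \<open>\<epsilon> / 2\<close> moves the risk and the empirical
  risk by at most \<open>\<epsilon> / 2\<close> each. Measurability of the generalization error
  follows from this.\<close>

lemma gen_error_countable:
  assumes \<omega>: "\<omega> \<in> space M"
  shows "gen_error D N l P \<omega> = (SUP p\<in>P0. risk D l p - emp_risk N l \<omega> p)" (is "_ = ?S0")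
proof (rule antisym)
  show "gen_error D N l P \<omega> \<le> ?S0"
    unfolding gen_error_def
  proof (rule cSUP_least[OF P])
    fix p assume p: "p \<in> P"
    show "risk D l p - emp_risk N l \<omega> p \<le> ?S0"
    proof (rule field_le_epsilon)
      fix \<epsilon> :: real assume "\<epsilon> > 0"
      then obtain q where q: "q \<in> P0" "\<forall>d\<in>space D. \<bar>l p d - l q d\<bar> \<le> \<epsilon> / 2"
        using dense[OF p, of "\<epsilon> / 2"] by auto
      have "(\<Sum>i=1..N. l q (\<omega> i)) \<le> (\<Sum>i=1..N. l p (\<omega> i) + \<epsilon> / 2)"
      proof (rule sum_mono)
        fix i assume "i \<in> {1..N}"
        then have "\<bar>l p (\<omega> i) - l q (\<omega> i)\<bar> \<le> \<epsilon> / 2" using q(2) space_M[OF \<omega>] by blast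
        then show "l q (\<omega> i) \<le> l p (\<omega> i) + \<epsilon> / 2" by linarith
      qed
      then have "(\<Sum>i=1..N. l q (\<omega> i)) \<le> (\<Sum>i=1..N. l p (\<omega> i)) + N * (\<epsilon> / 2)"
        by (simp add: sum.distrib)
      then have "emp_risk N l \<omega> q \<le> emp_risk N l \<omega> p + \<epsilon> / 2"
        using N by (simp add: emp_risk_def field_simps)
      moreover have "\<bar>risk D l p - risk D l q\<bar> \<le> \<epsilon> / 2"
        using p q P0(1) by (intro risk_dense) auto
      moreover have "risk D l q - emp_risk N l \<omega> q \<le> ?S0"
        using q by (intro cSUP_upper bdd_deviation \<omega> P0) auto
      ultimately show "risk D l p - emp_risk N l \<omega> p \<le> ?S0 + \<epsilon>" by linarith
    qed
  qed
  show "?S0 \<le> gen_error D N l P \<omega>"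
    unfolding gen_error_def
    by (intro cSUP_subset_mono P0 P0_nonempty bdd_deviation \<omega>) auto
qed

lemma deviation_le_gen_error:
  "\<omega> \<in> space M \<Longrightarrow> p \<in> P \<Longrightarrow> risk D l p - emp_risk N l \<omega> p \<le> gen_error D N l P \<omega>"
  unfolding gen_error_def by (intro cSUP_upper bdd_deviation) auto

lemma abs_gen_error_le:
  assumes "\<omega> \<in> space M"
  shows "\<bar>gen_error D N l P \<omega>\<bar> \<le> 2 * B"
proof -
  obtain p where p: "p \<in> P" using P by blast
  have "gen_error D N l P \<omega> \<le> 2 * B"
    unfolding gen_error_def using abs_risk_le abs_emp_risk_le[OF _ assms]
    by (intro cSUP_least P) (smt (verit))
  moreover have "- (2 * B) \<le> gen_error D N l P \<omega>"
    using deviation_le_gen_error[OF assms p] abs_risk_le[OF p] abs_emp_risk_le[OF p assms] by linarith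
  ultimately show ?thesis by linarith
qed

lemma integrable_gen_error: "integrable M (gen_error D N l P)"
proof -
  interpret M: prob_space M by (rule prob_space_M)
  have "(\<lambda>\<omega>. SUP p\<in>P0. risk D l p - emp_risk N l \<omega> p) \<in> borel_measurable M"
    using P0 by (intro borel_measurable_cSUP borel_measurable_diff measurable_emp_risk bdd_deviation) auto
  then have "gen_error D N l P \<in> borel_measurable M"
    by (subst measurable_cong[OF gen_error_countable])
  then show ?thesis
    by (intro M.integrable_const_bound[of _ "2 * B"] AE_I2) (auto intro: abs_gen_error_le)
qed

text \<open>The deviation of one fixed \<open>p\<close> has mean zero and is dominated by the
  supremum.\<close>

lemma integral_gen_error_nonneg: "0 \<le> (\<integral>\<omega>. gen_error D N l P \<omega> \<partial>M)"
proof -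
  interpret M: prob_space M by (rule prob_space_M)
  obtain p where p: "p \<in> P" using P by blast
  have "(\<integral>\<omega>. risk D l p - emp_risk N l \<omega> p \<partial>M) \<le> (\<integral>\<omega>. gen_error D N l P \<omega> \<partial>M)"
    by (intro integral_mono integrable_gen_error deviation_le_gen_error p
        Bochner_Integration.integrable_diff integrable_emp_risk) auto
  then show ?thesis
    using p by (simp add: integrable_emp_risk integral_emp_risk M.prob_space)
qed

text \<open>The estimation error splits into the deviation at \<open>phat \<omega>\<close>, at most
  the generalization error, the difference of empirical risks at \<open>phat \<omega>\<close> and
  \<open>pstar\<close>, which is nonpositive, and the negative deviation at \<open>pstar\<close>,
  which has mean zero because \<open>pstar\<close> does not depend on the sample.\<close>

lemma est_error_le_gen_error:
  assumes hat: "\<And>\<omega>. \<omega> \<in> space M \<Longrightarrow> is_arg_min (emp_risk N l \<omega>) (\<lambda>p. p \<in> P) (phat \<omega>)"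
    and star: "pstar \<in> P"
  shows "(\<lambda>\<omega>. est_error D l (phat \<omega>) pstar) \<in> borel_measurable M \<longrightarrow>
      integrable M (\<lambda>\<omega>. est_error D l (phat \<omega>) pstar)"
    and "(\<integral>\<omega>. est_error D l (phat \<omega>) pstar \<partial>M) \<le> (\<integral>\<omega>. gen_error D N l P \<omega> \<partial>M)"
proof -
  interpret M: prob_space M by (rule prob_space_M)
  let ?EE = "\<lambda>\<omega>. est_error D l (phat \<omega>) pstar"
  have hatP: "phat \<omega> \<in> P" "emp_risk N l \<omega> (phat \<omega>) \<le> emp_risk N l \<omega> pstar" if "\<omega> \<in> space M" for \<omega>
    using hat[OF that] star by (auto simp: is_arg_min_linorder)
  show int: "?EE \<in> borel_measurable M \<longrightarrow> integrable M ?EE"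
  proof
    have "\<bar>?EE \<omega>\<bar> \<le> 2 * B" if "\<omega> \<in> space M" for \<omega>
      using abs_risk_le[OF hatP(1)[OF that]] abs_risk_le[OF star] by (simp add: est_error_def)
    then show "integrable M ?EE" if "?EE \<in> borel_measurable M"
      using that by (intro M.integrable_const_bound[of _ "2 * B"] AE_I2) auto
  qed
  show "(\<integral>\<omega>. ?EE \<omega> \<partial>M) \<le> (\<integral>\<omega>. gen_error D N l P \<omega> \<partial>M)"
  proof (cases "integrable M ?EE")
    case True
    have "(\<integral>\<omega>. ?EE \<omega> \<partial>M) \<le> (\<integral>\<omega>. gen_error D N l P \<omega> + (emp_risk N l \<omega> pstar - risk D l pstar) \<partial>M)"
    proof (intro integral_mono True)
      fix \<omega> assume \<omega>: "\<omega> \<in> space M"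
      show "?EE \<omega> \<le> gen_error D N l P \<omega> + (emp_risk N l \<omega> pstar - risk D l pstar)"
        using deviation_le_gen_error[OF \<omega> hatP(1)[OF \<omega>]] hatP(2)[OF \<omega>] by (simp add: est_error_def)
    qed (use star in \<open>auto intro!: integrable_gen_error integrable_emp_risk\<close>)
    also have "\<dots> = (\<integral>\<omega>. gen_error D N l P \<omega> \<partial>M)"
      using star by (simp add: integrable_gen_error integrable_emp_risk integral_emp_risk M.prob_space)
    finally show ?thesis .
  next
    case False
    \<comment> \<open>A non-measurable choice of \<open>phat\<close> is possible; the Bochner
      integral then takes its default value 0.\<close>
    then show ?thesis using integral_gen_error_nonneg by (simp add: not_integrable_integral_eq)
  qed
qed

text \<open>Here \<open>z\<close> is a sample of size \<open>2 * N\<close>, its second half being the ghost sample.\<close>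

definition signed_deviation :: "(nat \<Rightarrow> real) \<Rightarrow> (nat \<Rightarrow> 'd) \<Rightarrow> real" where
  "signed_deviation \<sigma> z = (SUP p\<in>P0. \<Sum>i=1..N. \<sigma> i * (l p (z (N + i)) - l p (z i)))"

lemma abs_signed_sum_le:
  assumes "\<forall>i\<in>{1..N}. \<bar>\<sigma> i\<bar> = 1" "\<forall>i\<in>{1..2*N}. z i \<in> space D" "p \<in> P"
  shows "\<bar>\<Sum>i=1..N. \<sigma> i * (l p (z (N + i)) - l p (z i))\<bar> \<le> 2 * B * N"
proof -
  have "\<bar>\<Sum>i=1..N. \<sigma> i * (l p (z (N + i)) - l p (z i))\<bar>
      \<le> (\<Sum>i=1..N. \<bar>\<sigma> i * (l p (z (N + i)) - l p (z i))\<bar>)" by (rule sum_abs)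
  also have "\<dots> \<le> (\<Sum>i=1..N. 2 * B)"
  proof (rule sum_mono)
    fix i assume i: "i \<in> {1..N}"
    have "\<bar>l p (z (N + i))\<bar> \<le> B" "\<bar>l p (z i)\<bar> \<le> B"
      using i assms by (auto intro!: bound)
    then show "\<bar>\<sigma> i * (l p (z (N + i)) - l p (z i))\<bar> \<le> 2 * B"
      using assms(1) i by (simp add: abs_mult)
  qed
  finally show ?thesis by (simp add: mult.commute)
qed

lemma bdd_signed_sum:
  assumes "\<forall>i\<in>{1..N}. \<bar>\<sigma> i\<bar> = 1" "\<forall>i\<in>{1..2*N}. z i \<in> space D"
  shows "bdd_above ((\<lambda>p. \<Sum>i=1..N. \<sigma> i * (l p (z (N + i)) - l p (z i))) ` P0)"
proof (rule bdd_aboveI2)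
  fix p assume "p \<in> P0"
  then show "(\<Sum>i=1..N. \<sigma> i * (l p (z (N + i)) - l p (z i))) \<le> 2 * B * N"
    using abs_signed_sum_le[OF assms, of p] P0(1) by fastforce
qed

lemma abs_signed_deviation_le:
  assumes "\<forall>i\<in>{1..N}. \<bar>\<sigma> i\<bar> = 1" "\<forall>i\<in>{1..2*N}. z i \<in> space D"
  shows "\<bar>signed_deviation \<sigma> z\<bar> \<le> 2 * B * N"
proof -
  obtain p where p: "p \<in> P0" using P0_nonempty by blast
  have "signed_deviation \<sigma> z \<le> 2 * B * N"
    unfolding signed_deviation_def
  proof (rule cSUP_least[OF P0_nonempty])
    fix p assume "p \<in> P0"
    then show "(\<Sum>i=1..N. \<sigma> i * (l p (z (N + i)) - l p (z i))) \<le> 2 * B * N"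
      using abs_signed_sum_le[OF assms, of p] P0(1) by fastforce
  qed
  moreover have "(\<Sum>i=1..N. \<sigma> i * (l p (z (N + i)) - l p (z i))) \<le> signed_deviation \<sigma> z"
    unfolding signed_deviation_def by (intro cSUP_upper p bdd_signed_sum assms)
  ultimately show ?thesis using abs_signed_sum_le[OF assms, of p] p P0(1) by force
qed

abbreviation Q where "Q \<equiv> PiM {1..2*N} (\<lambda>_. D)"

lemma space_Q: "z \<in> space Q \<Longrightarrow> \<forall>i\<in>{1..2*N}. z i \<in> space D"
  by (auto simp: space_PiM PiE_def Pi_def)

lemma measurable_signed_deviation:
  assumes "\<forall>i\<in>{1..N}. \<bar>\<sigma> i\<bar> = 1"
  shows "signed_deviation \<sigma> \<in> borel_measurable Q"
proof -
  show ?thesis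
    unfolding signed_deviation_def
  proof (intro borel_measurable_cSUP P0 bdd_signed_sum assms borel_measurable_sum
        borel_measurable_times borel_measurable_diff borel_measurable_const)
    fix p i assume "p \<in> P0" "i \<in> {1..N}"
    then show "(\<lambda>z. l p (z (N + i))) \<in> borel_measurable Q" "(\<lambda>z. l p (z i)) \<in> borel_measurable Q"
      using P0(1) by (auto intro!: measurable_l_component simp del: One_nat_def)
  qed (rule space_Q)
qed

lemma integrable_signed_deviation:
  assumes "\<forall>i\<in>{1..N}. \<bar>\<sigma> i\<bar> = 1"
  shows "integrable Q (signed_deviation \<sigma>)"
proof -
  interpret Q: prob_space Q by (rule prob_space_PiM_D)
  show ?thesis
    by (intro Q.integrable_const_bound[of _ "2 * B * N"] AE_I2 measurable_signed_deviation assms)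
      (simp only: real_norm_def, rule abs_signed_deviation_le[OF assms space_Q])
qed

text \<open>Exchanging \<open>z i\<close> with \<open>z (N + i)\<close> preserves \<open>Q\<close> and flips the sign of the \<open>i\<close>-th summand.\<close>

lemma integral_signed_deviation:
  assumes \<sigma>: "\<sigma> \<in> sign_vectors {1..N}"
  shows "(\<integral>z. signed_deviation \<sigma> z \<partial>Q) = (\<integral>z. signed_deviation (\<lambda>_. 1) z \<partial>Q)"
proof -
  \<comment> \<open>This involution of \<open>{1..2*N}\<close> exchanges \<open>i\<close> and
    \<open>N + i\<close> for exactly those \<open>i\<close> with \<open>\<sigma> i = -1\<close>.
    Permuting independent, identically distributed coordinates preserves their joint law.\<close>
  define f where "f = (\<lambda>n. if n \<le> N then (if \<sigma> n = 1 then n else N + n)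
    else (if \<sigma> (n - N) = 1 then n else n - N))"
  have \<sigma>1: "\<sigma> i = 1 \<or> \<sigma> i = -1" if "i \<in> {1..N}" for i
    using \<sigma> that by (auto simp: sign_vectors_def PiE_def Pi_def)
  have fK: "f \<in> {1..2*N} \<rightarrow> {1..2*N}" by (auto simp: f_def)
  have ff: "f (f n) = n" if "n \<in> {1..2*N}" for n using that by (auto simp: f_def)
  have inj: "inj_on f {1..2*N}" by (rule inj_on_inverseI[of _ f]) (rule ff)
  define T where "T = (\<lambda>z::nat \<Rightarrow> 'd. \<lambda>n\<in>{1..2*N}. z (f n))"
  have QT: "Q = distr Q Q T"
    unfolding T_def using distr_PiM_reindex[of "{1..2*N}" "\<lambda>_. D" f "{1..2*N}"] fK inj prob_space_axioms
    by simp
  have T: "T \<in> measurable Q Q"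
    unfolding T_def by (intro measurable_restrict measurable_component_singleton) (use fK in auto)
  have swap: "signed_deviation (\<lambda>_. 1) (T z) = signed_deviation \<sigma> z" for z
    unfolding signed_deviation_def
  proof (intro SUP_cong refl sum.cong)
    fix p i assume i: "i \<in> {1..N}"
    then show "1 * (l p (T z (N + i)) - l p (T z i)) = \<sigma> i * (l p (z (N + i)) - l p (z i))"
      using \<sigma>1[OF i] by (auto simp: T_def f_def)
  qed
  have "(\<integral>z. signed_deviation (\<lambda>_. 1) z \<partial>Q) = (\<integral>z. signed_deviation (\<lambda>_. 1) z \<partial>distr Q Q T)"
    by (subst QT[symmetric]) simp
  also have "\<dots> = (\<integral>z. signed_deviation (\<lambda>_. 1) (T z) \<partial>Q)"
    by (intro integral_distr T measurable_signed_deviation) auto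
  finally show ?thesis by (simp add: swap)
qed

text \<open>The risk is the mean loss on an independent ghost sample, and the supremum of means is
  at most the mean of the supremum. The factor \<open>N\<close> appears because signed deviations
  are sums, not averages.\<close>

lemma integral_gen_error_le_signed_deviation:
  "N * (\<integral>\<omega>. gen_error D N l P \<omega> \<partial>M) \<le> (\<integral>z. signed_deviation (\<lambda>_. 1) z \<partial>Q)"
proof -
  interpret product_sigma_finite "\<lambda>_::nat. D" by standard
  let ?I = "{1..N}" and ?J = "{N + 1..2 * N}"
  let ?MI = "PiM ?I (\<lambda>_. D)" and ?MJ = "PiM ?J (\<lambda>_. D)"
  let ?W = "signed_deviation (\<lambda>_. 1)"
  interpret MI: prob_space ?MI by (rule prob_space_PiM_D)
  interpret MJ: prob_space ?MJ by (rule prob_space_PiM_D)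
  interpret pair: pair_prob_space ?MI ?MJ ..
  have IJ: "?I \<union> ?J = {1..2*N}" "?I \<inter> ?J = {}" by auto
  have merge_space: "merge ?I ?J (x, y) i \<in> space D"
    if "x \<in> space ?MI" "y \<in> space ?MJ" "i \<in> {1..2*N}" for x y i
    using that by (auto simp: merge_def space_PiM PiE_def Pi_def)
  have mW: "(\<lambda>z. ?W (merge ?I ?J z)) \<in> borel_measurable (?MI \<Otimes>\<^sub>M ?MJ)"
    by (rule measurable_compose[OF measurable_merge]) (simp only: IJ, rule measurable_signed_deviation, simp)
  have bW: "\<bar>?W (merge ?I ?J (x, y))\<bar> \<le> 2 * B * N" if "x \<in> space ?MI" "y \<in> space ?MJ" for x y
    using merge_space[OF that] by (intro abs_signed_deviation_le) auto
  have int_pair: "integrable (?MI \<Otimes>\<^sub>M ?MJ) (\<lambda>z. ?W (merge ?I ?J z))"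
    by (intro pair.P.integrable_const_bound[of _ "2 * B * N"] AE_I2 mW) (auto simp: space_pair_measure intro!: bW simp del: One_nat_def)
  have int_fst: "integrable ?MI (\<lambda>x. \<integral>y. ?W (merge ?I ?J (x, y)) \<partial>?MJ)"
    by (rule pair.integrable_fst'[OF int_pair])
  have int_snd: "integrable ?MJ (\<lambda>y. ?W (merge ?I ?J (x, y)))" if x: "x \<in> space ?MI" for x
  proof (rule MJ.integrable_const_bound[of _ "2 * B * N"])
    show "(\<lambda>y. ?W (merge ?I ?J (x, y))) \<in> borel_measurable ?MJ"
      by (rule measurable_compose[OF measurable_Pair1'[OF x] mW])
    show "AE y in ?MJ. norm (?W (merge ?I ?J (x, y))) \<le> 2 * B * N"
      using bW[OF x] by (intro AE_I2) (simp only: real_norm_def)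
  qed
  have "N * gen_error D N l P x \<le> (\<integral>y. ?W (merge ?I ?J (x, y)) \<partial>?MJ)" if x: "x \<in> space ?MI" for x
  proof -
    have xM: "x \<in> space M" using x by (simp add: samples_def)
    have "gen_error D N l P x \<le> (\<integral>y. ?W (merge ?I ?J (x, y)) \<partial>?MJ) / N"
      unfolding gen_error_countable[OF xM]
    proof (rule cSUP_least[OF P0_nonempty])
      fix p assume p: "p \<in> P0"
      then have pP: "p \<in> P" using P0 by auto
      have intJ: "integrable ?MJ (\<lambda>y. \<Sum>i=1..N. l p (y (N + i)) - l p (x i))"
        using pP by (intro Bochner_Integration.integrable_sum Bochner_Integration.integrable_diff
            integrable_l_component MJ.integrable_const) auto
      have "(\<integral>y. (\<Sum>i=1..N. l p (y (N + i)) - l p (x i)) \<partial>?MJ)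
          = (\<Sum>i=1..N. (\<integral>y. l p (y (N + i)) - l p (x i) \<partial>?MJ))"
        using pP by (intro Bochner_Integration.integral_sum Bochner_Integration.integrable_diff
            integrable_l_component MJ.integrable_const) auto
      also have "\<dots> = (\<Sum>i=1..N. risk D l p - l p (x i))"
      proof (intro sum.cong refl)
        fix i assume "i \<in> {1..N}"
        then have "N + i \<in> ?J" by auto
        from integral_l_component[OF pP this] integrable_l_component[OF pP this]
        show "(\<integral>y. l p (y (N + i)) - l p (x i) \<partial>?MJ) = risk D l p - l p (x i)"
          using MJ.prob_space MJ.integrable_const[of "l p (x i)"]
          by (subst Bochner_Integration.integral_diff) (simp_all del: One_nat_def MJ.integrable_const)
      qed
      also have "\<dots> = N * (risk D l p - emp_risk N l x p)"
        using N by (simp add: emp_risk_def sum_subtractf right_diff_distrib)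
      finally have "N * (risk D l p - emp_risk N l x p)
          = (\<integral>y. (\<Sum>i=1..N. l p (y (N + i)) - l p (x i)) \<partial>?MJ)" ..
      also have "\<dots> \<le> (\<integral>y. ?W (merge ?I ?J (x, y)) \<partial>?MJ)"
      proof (intro integral_mono intJ int_snd x)
        fix y assume y: "y \<in> space ?MJ"
        have "(\<Sum>i=1..N. l p (y (N + i)) - l p (x i))
            = (\<Sum>i=1..N. 1 * (l p (merge ?I ?J (x, y) (N + i)) - l p (merge ?I ?J (x, y) i)))"
          by (intro sum.cong) (auto simp: merge_def)
        also have "\<dots> \<le> ?W (merge ?I ?J (x, y))"
          unfolding signed_deviation_def
          by (rule cSUP_upper[OF p bdd_signed_sum]) (use merge_space[OF x y] in auto)
        finally show "(\<Sum>i=1..N. l p (y (N + i)) - l p (x i)) \<le> ?W (merge ?I ?J (x, y))" .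
      qed
      finally show "risk D l p - emp_risk N l x p \<le> (\<integral>y. ?W (merge ?I ?J (x, y)) \<partial>?MJ) / N"
        using N by (simp add: field_simps)
    qed
    then show ?thesis using N by (simp add: field_simps)
  qed
  then have "(\<integral>x. N * gen_error D N l P x \<partial>?MI) \<le> (\<integral>x. (\<integral>y. ?W (merge ?I ?J (x, y)) \<partial>?MJ) \<partial>?MI)"
    using integrable_gen_error int_fst by (intro integral_mono integrable_mult_right) (auto simp: samples_def)
  \<comment> \<open>Fubini: merging independent samples over the two halves of the index set gives
    the law \<open>Q\<close>.\<close>
  also have "\<dots> = (\<integral>z. ?W z \<partial>Q)"
    using product_integral_fold[of ?I ?J ?W] IJ integrable_signed_deviation[of "\<lambda>_. 1"] by simp
  finally show ?thesis by (simp add: samples_def)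
qed

text \<open>The integral of the signed deviation is the same for all signs, hence equals its average
  over them. Exchanging average and integral leaves a bound at each fixed double sample, where the
  two halves contribute \<open>c\<close> each.\<close>

theorem symmetrization:
  assumes rad: "\<And>x. (\<And>i. i \<in> {1..N} \<Longrightarrow> x i \<in> space D) \<Longrightarrow>
    rademacher_le {1..N} ((\<lambda>p i. l p (x i)) ` P) c"
  shows "(\<integral>\<omega>. gen_error D N l P \<omega> \<partial>M) \<le> 2 * c / N"
proof -
  interpret Q: prob_space Q by (rule prob_space_PiM_D)
  let ?\<Sigma> = "sign_vectors {1..N}"
  have pointwise: "(\<Sum>\<sigma>\<in>?\<Sigma>. signed_deviation \<sigma> z) \<le> 2 ^ N * (2 * c)" if z: "z \<in> space Q" for z
  proof -
    let ?F = "(\<lambda>p i. l p (z (N + i))) ` P" and ?G = "(\<lambda>f i. - f i) ` (\<lambda>p i. l p (z i)) ` P"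
    have "rademacher_le {1..N} ?F c"
      using rad[of "\<lambda>i. z (N + i)"] space_Q[OF z] by auto
    moreover have "rademacher_le {1..N} ?G c"
      using rad[of z] space_Q[OF z] by (intro rademacher_le_uminus) auto
    moreover define H where "H = {\<lambda>i. f i + g i |f g. f \<in> ?F \<and> g \<in> ?G}"
    ultimately have "rademacher_le {1..N} H (c + c)" by (simp only: rademacher_le_add)
    then obtain X where X: "\<And>\<sigma> f. \<sigma> \<in> ?\<Sigma> \<Longrightarrow> f \<in> H \<Longrightarrow> (\<Sum>i=1..N. \<sigma> i * f i) \<le> X \<sigma>"
      and SX: "(\<Sum>\<sigma>\<in>?\<Sigma>. X \<sigma>) \<le> 2 ^ card {1..N} * (c + c)"
      unfolding rademacher_le_def by blast
    have "signed_deviation \<sigma> z \<le> X \<sigma>" if \<sigma>: "\<sigma> \<in> ?\<Sigma>" for \<sigma>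
      unfolding signed_deviation_def
    proof (rule cSUP_least[OF P0_nonempty])
      fix p assume "p \<in> P0"
      then have p: "p \<in> P" using P0 by auto
      have "(\<lambda>i. l p (z (N + i)) + - l p (z i)) \<in> H"
        unfolding H_def
        by (intro CollectI exI[of _ "\<lambda>i. l p (z (N + i))"] exI[of _ "\<lambda>i. - l p (z i)"] conjI)
          (use p in auto)
      from X[OF \<sigma> this] show "(\<Sum>i=1..N. \<sigma> i * (l p (z (N + i)) - l p (z i))) \<le> X \<sigma>" by simp
    qed
    then have "(\<Sum>\<sigma>\<in>?\<Sigma>. signed_deviation \<sigma> z) \<le> (\<Sum>\<sigma>\<in>?\<Sigma>. X \<sigma>)" by (rule sum_mono)
    with SX show ?thesis by simp
  qed
  have int: "integrable Q (signed_deviation \<sigma>)" if "\<sigma> \<in> ?\<Sigma>" for \<sigma>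
    using that by (intro integrable_signed_deviation ballI sign_vectors_abs)
  have "2 ^ N * (\<integral>z. signed_deviation (\<lambda>_. 1) z \<partial>Q) = (\<Sum>\<sigma>\<in>?\<Sigma>. \<integral>z. signed_deviation \<sigma> z \<partial>Q)"
    by (simp add: integral_signed_deviation card_sign_vectors del: One_nat_def)
  also have "\<dots> = (\<integral>z. (\<Sum>\<sigma>\<in>?\<Sigma>. signed_deviation \<sigma> z) \<partial>Q)"
    by (intro Bochner_Integration.integral_sum[symmetric] int)
  also have "\<dots> \<le> 2 ^ N * (2 * c)"
    by (intro Q.integral_le_const AE_I2 pointwise Bochner_Integration.integrable_sum int)
  finally have "(\<integral>z. signed_deviation (\<lambda>_. 1) z \<partial>Q) \<le> 2 * c" by simp
  then show ?thesis
    using integral_gen_error_le_signed_deviation N by (simp add: field_simps)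
qed

end

section \<open>Base-stock policies\<close>

text \<open>An arriving order only moves from the pipeline to the stock, so the position changes by
  the new order and the demand alone. For \<open>r < L\<close> the truncated difference
  \<open>r - L\<close> points to the order at \<open>0\<close>, which vanishes.\<close>

lemma inv_position_Suc:
  assumes "r \<ge> 1"
  shows "inv_position x1 L S d (Suc r) = inv_position x1 L S d r + order_qty x1 L S d r - d r"
proof -
  have lev: "inv_level x1 L S d (Suc r) = inv_level x1 L S d r + order_qty x1 L S d (r - L) - d r"
    using inv_level_Suc[OF assms] by (simp add: inv_after_def)
  show ?thesis
  proof (cases "L \<le> r")
    case True
    then have "Suc r - L = Suc (r - L)" by simp
    moreover have "(\<Sum>t'\<in>{r - L..<Suc r}. order_qty x1 L S d t')
        = order_qty x1 L S d (r - L) + (\<Sum>t'\<in>{Suc (r - L)..<Suc r}. order_qty x1 L S d t')"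
      by (rule sum.atLeast_Suc_lessThan) simp
    moreover have "(\<Sum>t'\<in>{r - L..<Suc r}. order_qty x1 L S d t')
        = (\<Sum>t'\<in>{r - L..<r}. order_qty x1 L S d t') + order_qty x1 L S d r"
      by (rule sum.atLeastLessThan_Suc) simp
    ultimately show ?thesis unfolding inv_position_def lev by (simp only:)
  next
    case False
    then show ?thesis by (simp add: inv_position_def lev order_qty_0)
  qed
qed

text \<open>Orders placed from period \<open>r\<close> on arrive no earlier than
  \<open>r + L\<close>; until then the stock is fed only by the pipeline already counted in the
  position. At \<open>k = L\<close> the remaining pipeline sum is empty.\<close>

lemma inv_level_ahead:
  assumes "r \<ge> 1" "k \<le> L"
  shows "inv_level x1 L S d (r + k) + (\<Sum>t'\<in>{r + k - L..<r}. order_qty x1 L S d t')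
    = inv_position x1 L S d r - (\<Sum>u\<in>{r..<r + k}. d u)"
  using assms(2)
proof (induction k)
  case 0
  then show ?case by (simp add: inv_position_def)
next
  case (Suc k)
  have lev: "inv_level x1 L S d (Suc (r + k))
      = inv_level x1 L S d (r + k) + order_qty x1 L S d (r + k - L) - d (r + k)"
    using inv_level_Suc[of "r + k"] assms(1) by (simp add: inv_after_def)
  have "order_qty x1 L S d (r + k - L) + (\<Sum>t'\<in>{Suc (r + k) - L..<r}. order_qty x1 L S d t')
      = (\<Sum>t'\<in>{r + k - L..<r}. order_qty x1 L S d t')"
  proof (cases "L \<le> r + k")
    case True
    then show ?thesis
      using Suc.prems by (simp add: Suc_diff_le sum.atLeast_Suc_lessThan)
  next
    case False
    then show ?thesis by (simp add: order_qty_0)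
  qed
  then show ?case using Suc lev by simp
qed

text \<open>The position \<open>z\<close> after ordering obeys the Lindley-type recursion
  \<open>z (r + 1) = max (S (r + 1)) (z r - d r)\<close>. Since \<open>x1 \<le> 0 \<le> S 1\<close>,
  the first order raises it to exactly \<open>S 1\<close>, and \<open>x1\<close> disappears.\<close>

lemma inv_position_after_order:
  assumes "r \<ge> 1" "x1 \<le> 0" "\<forall>s\<in>{1..r}. 0 \<le> S s"
  shows "inv_position x1 L S d r + order_qty x1 L S d r
    = Max ((\<lambda>s. S s - (\<Sum>u\<in>{s..<r}. d u)) ` {1..r})"
  using assms(1,3)
proof (induction r rule: dec_induct)
  case base
  have "(\<Sum>t'\<in>{1 - L..<1}. order_qty x1 L S d t') = 0"
    by (cases L) (auto simp: order_qty_0)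
  then have "inv_position x1 L S d 1 = x1"
    using inv_level_1[of x1 L S d] by (simp add: inv_position_def)
  then show ?case
    using base assms(2) order_qty_base_stock[of 1 x1 L S d] by simp
next
  case (step r)
  let ?f = "\<lambda>r s. S s - (\<Sum>u\<in>{s..<r}. d u)"
  have "{1..Suc r} = insert (Suc r) {1..r}" using step.hyps by auto
  then have "Max (?f (Suc r) ` {1..Suc r}) = max (S (Suc r)) (Max (?f (Suc r) ` {1..r}))"
    using step.hyps by simp
  also have "?f (Suc r) ` {1..r} = (\<lambda>s. ?f r s + - d r) ` {1..r}"
    by (intro image_cong) auto
  also have "Max \<dots> = Max (?f r ` {1..r}) + - d r"
    using step.hyps by (intro Max_add_commute) auto
  also have "Max (?f r ` {1..r}) = inv_position x1 L S d r + order_qty x1 L S d r"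
    using step by simp
  also have "max (S (Suc r)) (\<dots> + - d r) = inv_position x1 L S d (Suc r) + order_qty x1 L S d (Suc r)"
    using step.hyps by (simp add: inv_position_Suc order_qty_base_stock)
  finally show ?case ..
qed

definition net_inventory :: "nat \<Rightarrow> nat \<Rightarrow> (nat \<Rightarrow> real) \<Rightarrow> (nat \<Rightarrow> real) \<Rightarrow> real" where
  "net_inventory L r S d = Max ((\<lambda>s. S s - (\<Sum>u\<in>{s..r + L}. d u)) ` {1..r})"

lemma inv_after_eq_net_inventory:
  assumes "r \<ge> 1" "x1 \<le> 0" "\<forall>s\<in>{1..r}. 0 \<le> S s"
  shows "inv_after x1 L S d (r + L) - d (r + L) = net_inventory L r S d"
proof -
  have "inv_after x1 L S d (r + L) - d (r + L)
      = inv_position x1 L S d r + order_qty x1 L S d r - (\<Sum>u\<in>{r..r + L}. d u)"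
    using inv_level_ahead[OF assms(1) order_refl, of x1 L S d]
    by (simp add: inv_after_def atLeastLessThanSuc_atLeastAtMost[symmetric])
  also have "\<dots> = Max ((\<lambda>s. S s - (\<Sum>u\<in>{s..<r}. d u)) ` {1..r}) + - (\<Sum>u\<in>{r..r + L}. d u)"
    by (simp add: inv_position_after_order[OF assms])
  also have "\<dots> = Max ((\<lambda>s. S s - (\<Sum>u\<in>{s..<r}. d u) + - (\<Sum>u\<in>{r..r + L}. d u)) ` {1..r})"
    using assms(1) by (intro Max_add_commute[symmetric]) auto
  also have "\<dots> = net_inventory L r S d"
    unfolding net_inventory_def
  proof (intro arg_cong[where f = Max] image_cong refl)
    fix s assume "s \<in> {1..r}"
    then have "(\<Sum>u\<in>{s..<r}. d u) + (\<Sum>u\<in>{r..<Suc (r + L)}. d u) = (\<Sum>u\<in>{s..<Suc (r + L)}. d u)"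
      by (intro sum.atLeastLessThan_concat) auto
    then show "S s - (\<Sum>u\<in>{s..<r}. d u) + - (\<Sum>u\<in>{r..r + L}. d u) = S s - (\<Sum>u\<in>{s..r + L}. d u)"
      unfolding atLeastLessThanSuc_atLeastAtMost by linarith
  qed
  finally show ?thesis .
qed

lemma loss_eq:
  assumes "x1 \<le> 0" "\<forall>s\<in>{1..T}. 0 \<le> S s"
  shows "loss 0 h b x1 L T S d
    = 1 / T * (\<Sum>r=1..T. holding_backlog_cost h b (net_inventory L r S d))"
proof -
  have "(\<Sum>t=L+1..T+L. period_loss 0 h b x1 L t S d) = (\<Sum>r=1..T. period_loss 0 h b x1 L (r + L) S d)"
    using sum.shift_bounds_cl_nat_ivl[of "\<lambda>t. period_loss 0 h b x1 L t S d" 1 L T]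
    by (simp add: add.commute)
  also have "\<dots> = (\<Sum>r=1..T. holding_backlog_cost h b (net_inventory L r S d))"
    using assms by (intro sum.cong refl) (simp add: period_loss_def inv_after_eq_net_inventory)
  finally show ?thesis by (simp add: loss_def)
qed

section \<open>The class of losses for fixed parameters\<close>

lemma holding_backlog_cost_lipschitz:
  assumes "h \<in> {0..1}" "b \<in> {0..1}"
  shows "\<bar>holding_backlog_cost h b x - holding_backlog_cost h b y\<bar> \<le> \<bar>x - y\<bar>"
proof -
  let ?u = "max x 0 - max y 0" and ?v = "max (- x) 0 - max (- y) 0"
  have "\<bar>holding_backlog_cost h b x - holding_backlog_cost h b y\<bar> = \<bar>h * ?u + b * ?v\<bar>"
    by (simp add: holding_backlog_cost_def algebra_simps)
  also have "\<dots> \<le> h * \<bar>?u\<bar> + b * \<bar>?v\<bar>"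
    using assms by (intro order_trans[OF abs_triangle_ineq]) (simp add: abs_mult)
  also have "\<dots> \<le> 1 * \<bar>?u\<bar> + 1 * \<bar>?v\<bar>"
    using assms by (intro add_mono mult_right_mono) auto
  \<comment> \<open>The variations of the positive and the negative part add up to
    \<open>\<bar>x - y\<bar>\<close>, so no factor 2 is lost.\<close>
  also have "\<dots> \<le> \<bar>x - y\<bar>" by (auto simp: max_def)
  finally show ?thesis .
qed

locale base_stock_instance =
  fixes b h U x1 :: real and L T :: nat
  assumes b: "b \<in> {0..1}" and h: "h \<in> {0..1}" and U: "U > 0" and T: "T > 0" and x1: "x1 \<le> 0"
begin

definition H where "H = real (L + 1) * U"

abbreviation "cost \<equiv> holding_backlog_cost h b"
abbreviation "P \<equiv> base_stock_policies H L T"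
abbreviation "l \<equiv> loss 0 h b x1 L T"

lemma H: "H > 0"
  using U by (simp add: H_def)

lemma policyD: "S \<in> P \<Longrightarrow> s \<in> {1..T+L} \<Longrightarrow> 0 \<le> S s \<and> S s \<le> H"
  by (auto simp: base_stock_policies_def PiE_def Pi_def)

lemma demandD: "d \<in> space (demand_space U L T) \<Longrightarrow> s \<in> {1..T+L} \<Longrightarrow> 0 \<le> d s \<and> d s \<le> U"
  by (auto simp: demand_space_def space_PiM space_restrict_space PiE_def Pi_def)

lemma l_eq: "S \<in> P \<Longrightarrow> l S d = 1 / T * (\<Sum>r=1..T. cost (net_inventory L r S d))"
  using policyD by (intro loss_eq x1) auto

text \<open>For the lower bound the index \<open>s = r\<close> suffices: it meets only
  \<open>L + 1\<close> demands, which is where \<open>H = (L + 1) * U\<close> enters. The range is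
  therefore the same for all \<open>r\<close>.\<close>

lemma net_inventory_bounds:
  assumes S: "S \<in> P" and d: "d \<in> space (demand_space U L T)" and r: "r \<in> {1..T}"
  shows "- H \<le> net_inventory L r S d" "net_inventory L r S d \<le> H"
proof -
  have "(\<Sum>u\<in>{r..r + L}. d u) \<le> of_nat (card {r..r + L}) * U"
    using r by (intro sum_bounded_above) (use demandD[OF d] in auto)
  then have "- H \<le> S r - (\<Sum>u\<in>{r..r + L}. d u)"
    using policyD[OF S, of r] r by (simp add: H_def)
  also have "\<dots> \<le> net_inventory L r S d"
    unfolding net_inventory_def using r by (intro Max_ge) auto
  finally show "- H \<le> net_inventory L r S d" .
  have "S s - (\<Sum>u\<in>{s..r + L}. d u) \<le> H" if "s \<in> {1..r}" for s
  proof -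
    have "0 \<le> (\<Sum>u\<in>{s..r + L}. d u)"
      using r that by (intro sum_nonneg) (use demandD[OF d] in auto)
    then show ?thesis using policyD[OF S, of s] r that by simp
  qed
  then show "net_inventory L r S d \<le> H"
    unfolding net_inventory_def using r by simp
qed

lemma abs_l_le:
  assumes "S \<in> P" "d \<in> space (demand_space U L T)"
  shows "\<bar>l S d\<bar> \<le> H"
proof -
  have "\<bar>cost (net_inventory L r S d)\<bar> \<le> H" if "r \<in> {1..T}" for r
    using net_inventory_bounds[OF assms that]
      holding_backlog_cost_lipschitz[OF h b, of "net_inventory L r S d" 0]
    by (simp add: holding_backlog_cost_def[of h b 0])
  then have "(\<Sum>r=1..T. \<bar>cost (net_inventory L r S d)\<bar>) \<le> (\<Sum>r=1..T. H)" by (intro sum_mono)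
  then have "\<bar>\<Sum>r=1..T. cost (net_inventory L r S d)\<bar> \<le> T * H"
    by (intro order_trans[OF sum_abs]) simp
  then show ?thesis using T by (simp add: l_eq[OF assms(1)] abs_mult field_simps)
qed

lemma l_close:
  assumes "S \<in> P" "S' \<in> P" "\<forall>s\<in>{1..T}. \<bar>S s - S' s\<bar> \<le> \<epsilon>"
  shows "\<bar>l S d - l S' d\<bar> \<le> \<epsilon>"
proof -
  have "\<bar>cost (net_inventory L r S d) - cost (net_inventory L r S' d)\<bar> \<le> \<epsilon>" if "r \<in> {1..T}" for r
  proof -
    have "\<bar>net_inventory L r S d - net_inventory L r S' d\<bar> \<le> \<epsilon>"
      unfolding net_inventory_def using that assms(3) by (intro abs_Max_diff_le) auto
    then show ?thesis using holding_backlog_cost_lipschitz[OF h b] order_trans by blast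
  qed
  then have "(\<Sum>r=1..T. \<bar>cost (net_inventory L r S d) - cost (net_inventory L r S' d)\<bar>) \<le> (\<Sum>r=1..T. \<epsilon>)"
    by (intro sum_mono)
  then have "\<bar>\<Sum>r=1..T. cost (net_inventory L r S d) - cost (net_inventory L r S' d)\<bar> \<le> T * \<epsilon>"
    by (intro order_trans[OF sum_abs]) simp
  moreover have "l S d - l S' d
      = (\<Sum>r=1..T. cost (net_inventory L r S d) - cost (net_inventory L r S' d)) / T"
    by (simp add: l_eq[OF assms(1)] l_eq[OF assms(2)] sum_subtractf diff_divide_distrib)
  ultimately show ?thesis using T by (simp add: divide_le_eq mult.commute)
qed

lemma measurable_l:
  assumes "S \<in> P"
  shows "l S \<in> borel_measurable (demand_space U L T)"
proof -
  have "(\<lambda>d. d u) \<in> borel_measurable (demand_space U L T)" if "u \<in> {1..T+L}" for u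
    using measurable_component_singleton[OF that, of "\<lambda>_. restrict_space borel {0..U}"]
    unfolding demand_space_def by (simp add: measurable_restrict_space2_iff)
  then have "net_inventory L r S \<in> borel_measurable (demand_space U L T)" if "r \<in> {1..T}" for r
    unfolding net_inventory_def using that
    by (intro borel_measurable_Max borel_measurable_diff borel_measurable_sum) auto
  then have "(\<lambda>d. 1 / T * (\<Sum>r=1..T. cost (net_inventory L r S d))) \<in> borel_measurable (demand_space U L T)"
    unfolding holding_backlog_cost_def
    by (intro borel_measurable_times borel_measurable_sum borel_measurable_add borel_measurable_max
        borel_measurable_uminus borel_measurable_const)
  then show ?thesis by (simp add: l_eq[OF assms, abs_def])
qed

definition P0 where "P0 = PiE {1..T+L} (\<lambda>_. {0..H} \<inter> \<rat>)"

lemma countable_P0: "countable P0"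
  unfolding P0_def by (intro countable_PiE) (auto intro: countable_Int2 countable_rat)

lemma P0_subset: "P0 \<subseteq> P"
  unfolding P0_def base_stock_policies_def by (intro PiE_mono) auto

lemma P0_dense:
  assumes S: "S \<in> P" and "\<epsilon> > 0"
  shows "\<exists>S'\<in>P0. \<forall>d. \<bar>l S d - l S' d\<bar> \<le> \<epsilon>"
proof -
  have "\<exists>q. q \<in> {0..H} \<inter> \<rat> \<and> \<bar>S s - q\<bar> \<le> \<epsilon>" if "s \<in> {1..T+L}" for s
  proof (cases "S s = 0")
    case True
    then show ?thesis using H \<open>\<epsilon> > 0\<close> by (intro exI[of _ 0]) auto
  next
    case False
    \<comment> \<open>The rational is sought below \<open>S s\<close> in order to stay in
      \<open>[0, H]\<close>; this requires \<open>S s > 0\<close>, while the level 0 is itself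
      rational.\<close>
    then have "max 0 (S s - \<epsilon>) < S s" using policyD[OF S that] \<open>\<epsilon> > 0\<close> by auto
    then obtain q where "q \<in> \<rat>" "max 0 (S s - \<epsilon>) < q" "q < S s" using Rats_dense_in_real by blast
    then show ?thesis using policyD[OF S that] by (intro exI[of _ q]) auto
  qed
  then obtain q where q: "\<And>s. s \<in> {1..T+L} \<Longrightarrow> q s \<in> {0..H} \<inter> \<rat> \<and> \<bar>S s - q s\<bar> \<le> \<epsilon>"
    by metis
  define S' where "S' = restrict q {1..T+L}"
  have "S' \<in> P0" using q unfolding P0_def S'_def by auto
  moreover have "\<bar>l S d - l S' d\<bar> \<le> \<epsilon>" for d
    using q \<open>S' \<in> P0\<close> P0_subset by (intro l_close S) (auto simp: S'_def)
  ultimately show ?thesis by blast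
qed

lemma rademacher_le_cost:
  assumes I: "finite I" and x: "\<And>i. i \<in> I \<Longrightarrow> x i \<in> space (demand_space U L T)" and r: "r \<in> {1..T}"
  shows "rademacher_le I ((\<lambda>S i. cost (net_inventory L r S (x i))) ` P) (386 * H * sqrt (card I))"
proof -
  \<comment> \<open>Since the maximum is at least \<open>- H\<close>, truncating cumulative demand at \<open>2 * H\<close> and adding an
    index \<open>0\<close> of level \<open>H\<close> with demand \<open>2 * H\<close> do not change it.\<close>
  define e where "e = (\<lambda>i s. if s = 0 then 2 * H else min (2 * H) (\<Sum>u\<in>{s..r + L}. x i u))"
  have pos: "0 \<le> (\<Sum>u\<in>{s..r + L}. x i u)" if "i \<in> I" "s \<ge> 1" for i s
    using r that by (intro sum_nonneg) (use demandD[OF x[OF that(1)]] in auto)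
  have anti: "e i s' \<le> e i s" if "i \<in> I" "s \<le> s'" "s' \<le> r" for i s s'
  proof (cases "s = 0")
    case False
    then have "(\<Sum>u\<in>{s'..r + L}. x i u) \<le> (\<Sum>u\<in>{s..r + L}. x i u)"
      using r that by (intro sum_mono2) (use demandD[OF x[OF that(1)]] in auto)
    then show ?thesis using that False by (auto simp: e_def)
  qed (auto simp: e_def)
  interpret antimono_curves I e r H cost
  proof
    show "0 \<le> e i s \<and> e i s \<le> 2 * H" if "i \<in> I" "s \<le> r" for i s
      using pos[OF that(1), of s] H by (auto simp: e_def)
  qed (use I H anti holding_backlog_cost_lipschitz[OF h b] in auto)
  have envelope_eq: "envelope (S(0 := H)) i = cost (net_inventory L r S (x i))" if S: "S \<in> P" and i: "i \<in> I" for S i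
  proof -
    let ?S = "S(0 := H)"
    have low: "- H \<le> net_inventory L r S (x i)" by (rule net_inventory_bounds(1)[OF S x[OF i] r])
    have "Max ((\<lambda>s. ?S s - e i s) ` {..r}) = net_inventory L r S (x i)"
    proof (rule antisym)
      have "?S s - e i s \<le> net_inventory L r S (x i)" if "s \<le> r" for s
      proof (cases "s = 0")
        case False
        then have "S s - (\<Sum>u\<in>{s..r + L}. x i u) \<le> net_inventory L r S (x i)"
          unfolding net_inventory_def using that by (intro Max_ge) auto
        \<comment> \<open>Where the truncation is active the term is at most
          \<open>H - 2 * H = - H\<close>, already below the maximum.\<close>
        then show ?thesis using False low policyD[OF S, of s] r that by (auto simp: e_def min_def)
      qed (use low in \<open>simp add: e_def\<close>)
      then show "Max ((\<lambda>s. ?S s - e i s) ` {..r}) \<le> net_inventory L r S (x i)" by simp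
      have "S s - (\<Sum>u\<in>{s..r + L}. x i u) \<le> Max ((\<lambda>s. ?S s - e i s) ` {..r})" if "s \<in> {1..r}" for s
      proof -
        have "?S s - e i s \<le> Max ((\<lambda>s. ?S s - e i s) ` {..r})"
          using that by (intro Max_ge) (auto simp del: fun_upd_apply)
        then show ?thesis using that by (auto simp: e_def)
      qed
      then show "net_inventory L r S (x i) \<le> Max ((\<lambda>s. ?S s - e i s) ` {..r})"
        unfolding net_inventory_def using r by simp
    qed
    then show ?thesis by (simp add: envelope_def)
  qed
  have pol: "S(0 := H) \<in> levels" if "S \<in> P" for S
    using policyD[OF that] r H by (auto simp: levels_def)
  show ?thesis
  proof (rule rademacher_le_subset[OF rademacher_le_envelope order_refl])
    fix f assume "f \<in> (\<lambda>S i. cost (net_inventory L r S (x i))) ` P"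
    then obtain S where S: "S \<in> P" "f = (\<lambda>i. cost (net_inventory L r S (x i)))" by blast
    show "\<exists>g\<in>envelope ` levels. \<forall>i\<in>I. f i = g i"
      by (rule bexI[OF _ imageI[OF pol[OF S(1)]]]) (use envelope_eq S in auto)
  qed
qed

text \<open>Every period has the same bound, so the normalization \<open>1 / T\<close> cancels the
  number of periods.\<close>

lemma rademacher_le_l:
  assumes "finite I" "\<And>i. i \<in> I \<Longrightarrow> x i \<in> space (demand_space U L T)"
  shows "rademacher_le I ((\<lambda>S i. l S (x i)) ` P) (386 * H * sqrt (card I))"
proof -
  have "rademacher_le I ((\<lambda>S i. \<Sum>r=1..T. cost (net_inventory L r S (x i))) ` P)
      (\<Sum>r=1..T. 386 * H * sqrt (card I))"
    using assms by (intro rademacher_le_sum rademacher_le_cost) auto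
  from rademacher_le_scale[OF this, of "1 / T"]
  have "rademacher_le I ((\<lambda>f i. 1 / T * f i) ` (\<lambda>S i. \<Sum>r=1..T. cost (net_inventory L r S (x i))) ` P)
      (386 * H * sqrt (card I))"
    using T by simp
  then show ?thesis
    by (rule rademacher_le_subset) (auto simp: l_eq)
qed

end

text \<open>As \<open>phat\<close> is an arbitrary choice of empirical minimizers, measurability of
  \<open>EE\<close> appears as a premise for its integrability; for \<open>GE\<close> it is
  established.\<close>

theorem corollary4:
  "\<exists>C::real. C > 0 \<and>
     (\<forall>(b::real) (h::real) (L::nat) (U::real) (T::nat) (N::nat) (x1::real)
        (D :: (nat \<Rightarrow> real) measure).
        b \<in> {0..1} \<longrightarrow> h \<in> {0..1} \<longrightarrow> U > 0 \<longrightarrow> T > 0 \<longrightarrow> N > 0 \<longrightarrow> x1 \<le> 0 \<longrightarrow>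
        prob_space D \<longrightarrow> sets D = sets (demand_space U L T) \<longrightarrow>
        (let H = real (L + 1) * U;
             P = base_stock_policies H L T;
             l = loss 0 h b x1 L T;
             M = samples D N;
             GE = gen_error D N l P
         in
           (\<forall>phat pstar.
              (\<forall>\<omega>\<in>space M. is_arg_min (emp_risk N l \<omega>) (\<lambda>p. p \<in> P) (phat \<omega>)) \<longrightarrow>
              is_arg_min (risk D l) (\<lambda>p. p \<in> P) pstar \<longrightarrow>
              (let EE = (\<lambda>\<omega>. est_error D l (phat \<omega>) pstar) in
                 (EE \<in> borel_measurable M \<longrightarrow> integrable M EE) \<and>
                 (\<integral>\<omega>. EE \<omega> \<partial>M) \<le> (\<integral>\<omega>. GE \<omega> \<partial>M))) \<and>
           integrable M GE \<and>
           (\<integral>\<omega>. GE \<omega> \<partial>M) \<le> C * real (L + 1) * U * sqrt (1 / real N)))"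
proof (intro exI[of _ "772::real"] conjI allI impI)
  fix b h U x1 :: real and L T N :: nat and D :: "(nat \<Rightarrow> real) measure"
  assume "b \<in> {0..1}" "h \<in> {0..1}" "U > 0" "T > 0" "x1 \<le> 0" and N: "N > 0" and "prob_space D"
    and sets: "sets D = sets (demand_space U L T)"
  interpret D: prob_space D by fact
  interpret base_stock_instance b h U x1 L T by standard fact+
  have space: "space D = space (demand_space U L T)" by (rule sets_eq_imp_space_eq[OF sets])
  have "(\<lambda>s\<in>{1..T+L}. 0) \<in> P0" unfolding P0_def using H by auto
  then have "P \<noteq> {}" using P0_subset by blast
  interpret C: bounded_loss_class D l P P0 H N
  proof
    show "l p \<in> borel_measurable D" if "p \<in> P" for p
      using measurable_l[OF that] by (simp only: measurable_cong_sets[OF sets refl])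
    show "\<exists>q\<in>P0. \<forall>d\<in>space D. \<bar>l p d - l q d\<bar> \<le> \<epsilon>" if "p \<in> P" "\<epsilon> > 0" for p \<epsilon>
      using P0_dense[OF that] by blast
  qed (use countable_P0 P0_subset \<open>P \<noteq> {}\<close> N space abs_l_le in auto)
  \<comment> \<open>Symmetrization doubles the Rademacher bound, so the final constant is
    \<open>772 = 2 * 386\<close>.\<close>
  have "(\<integral>\<omega>. gen_error D N l P \<omega> \<partial>samples D N) \<le> 2 * (386 * H * sqrt N) / N"
    using rademacher_le_l[of "{1..N}"] by (intro C.symmetrization) (simp add: space)
  also have "\<dots> = 772 * real (L + 1) * U * sqrt (1 / N)"
    using sqrt_divide_self_eq[of "real N"]
    by (simp add: H_def real_sqrt_divide inverse_eq_divide mult.assoc flip: times_divide_eq_right)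
  finally have GE: "(\<integral>\<omega>. gen_error D N l P \<omega> \<partial>samples D N) \<le> 772 * real (L + 1) * U * sqrt (1 / N)" .
  show "let H = real (L + 1) * U;
             P = base_stock_policies H L T;
             l = loss 0 h b x1 L T;
             M = samples D N;
             GE = gen_error D N l P
         in
           (\<forall>phat pstar.
              (\<forall>\<omega>\<in>space M. is_arg_min (emp_risk N l \<omega>) (\<lambda>p. p \<in> P) (phat \<omega>)) \<longrightarrow>
              is_arg_min (risk D l) (\<lambda>p. p \<in> P) pstar \<longrightarrow>
              (let EE = (\<lambda>\<omega>. est_error D l (phat \<omega>) pstar) in
                 (EE \<in> borel_measurable M \<longrightarrow> integrable M EE) \<and>
                 (\<integral>\<omega>. EE \<omega> \<partial>M) \<le> (\<integral>\<omega>. GE \<omega> \<partial>M))) \<and>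
           integrable M GE \<and>
           (\<integral>\<omega>. GE \<omega> \<partial>M) \<le> 772 * real (L + 1) * U * sqrt (1 / real N)"
    unfolding Let_def H_def[symmetric]
  proof (intro conjI allI impI)
    fix phat pstar
    assume hat: "\<forall>\<omega>\<in>space (samples D N). is_arg_min (emp_risk N l \<omega>) (\<lambda>p. p \<in> P) (phat \<omega>)"
      and star: "is_arg_min (risk D l) (\<lambda>p. p \<in> P) pstar"
    have "pstar \<in> P" using star by (simp add: is_arg_min_def)
    note EE = C.est_error_le_gen_error[OF _ this, of phat]
    show "integrable (samples D N) (\<lambda>\<omega>. est_error D l (phat \<omega>) pstar)"
      if "(\<lambda>\<omega>. est_error D l (phat \<omega>) pstar) \<in> borel_measurable (samples D N)"
      using EE(1) hat that by blast
    show "(\<integral>\<omega>. est_error D l (phat \<omega>) pstar \<partial>samples D N) \<le> (\<integral>\<omega>. gen_error D N l P \<omega> \<partial>samples D N)"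
      using EE(2) hat by blast
  qed (use C.integrable_gen_error GE in auto)
qed simp

end
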